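(* Let $G$ be a finite abelian group and let $S \subseteq G\setminus\{1_G\}$ be a nonempty subset with $S=S^{-1}$ such that the Cayley graph $\mathrm{Cay}(G,S)$ is connected. Then $\mathrm{Cay}(G,S)$ is balanced if and only if it is isomorphic to an $(l,t)$-cycle, for some positive integers $l,t$ with $l=2$ or ($l\equiv 0 \pmod 4$ and $l\geq 8$).
   Context: Graphs are finite, simple and undirected. A graph is balanced if it is bipartite and has no induced circuit (cycle) of length congruent to $2 \pmod 4$. For a group $G$ and a subset $S=S^{-1}\subseteq G$, the Cayley graph $\mathrm{Cay}(G,S)$ has vertex set $G$ and edge set $\{\{g,h\} \mid gh^{-1}\in S\}$. The lexicographic product of a graph $X$ with a graph $Y$ has vertex set $V(X)\times V(Y)$, where $(x,y)$ and $(x',y')$ are adjacent if and only if either $\{x,x'\}\in E(X)$, or $x=x'$ and $\{y,y'\}\in E(Y)$. $\overline{K_t}$ is the graph with $t$ vertices and no edges. $C_l$ is the cycle of length $l$, with the convention $C_2=K_2$. For positive integers $l,t$ with $l=2$, or $l\equiv 0\pmod 4$ and $l\geq 8$, an $(l,t)$-cycle is the lexicographic product of $C_l$ with $\overline{K_t}$. *)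

theory Defs
  imports
    "HOL-Algebra.Group"
    "Graph_Theory.Digraph_Isomorphism"
    "Graph_Theory.Pair_Digraph"
begin

text \<open>
  Finite simple graphs are represented as symmetric, loop-free digraphs without parallel arcs
  (locale \<^locale>\<open>pair_graph\<close>): the edge \<open>{u, v}\<close> is the pair of arcs \<open>(u, v)\<close>, \<open>(v, u)\<close>.
\<close>

definition cayley_graph :: "('a, 'b) monoid_scheme \<Rightarrow> 'a set \<Rightarrow> 'a pair_pre_digraph" where
  "cayley_graph G S =
    \<lparr> pverts = carrier G,
      parcs = {(g, h). g \<in> carrier G \<and> h \<in> carrier G \<and> g \<otimes>\<^bsub>G\<^esub> inv\<^bsub>G\<^esub> h \<in> S} \<rparr>"

lemma (in group) pair_graph_cayley_graph:
  assumes "finite (carrier G)" "S \<subseteq> carrier G - {\<one>}" "S = m_inv G ` S"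
  shows "pair_graph (cayley_graph G S)"
proof -
  have "parcs (cayley_graph G S) \<subseteq> carrier G \<times> carrier G"
    by (auto simp: cayley_graph_def)
  then have fin: "finite (parcs (cayley_graph G S))"
    using assms(1) by (meson finite_SigmaI finite_subset)
  have flip: "h \<otimes> inv g \<in> S" if "g \<in> carrier G" "h \<in> carrier G" "g \<otimes> inv h \<in> S" for g h
  proof -
    have "inv (g \<otimes> inv h) = h \<otimes> inv g"
      using that by (simp add: inv_mult_group)
    then show ?thesis using that(3) assms(3) by (metis imageI)
  qed
  show ?thesis
  proof
    show "symmetric (with_proj (cayley_graph G S))"
      by (auto simp: symmetric_def cayley_graph_def intro!: symI flip)
  qed (use assms fin in \<open>auto simp: cayley_graph_def\<close>)
qed

text \<open>
  The cycle \<open>C\<^sub>l\<close> on the residues modulo \<open>l\<close>, for \<open>l \<ge> 2\<close>. For \<open>l = 2\<close> the two neighbours of a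
  vertex coincide, which gives \<open>C\<^sub>2 = K\<^sub>2\<close>.
\<close>

definition cycle_graph :: "nat \<Rightarrow> nat pair_pre_digraph" where
  "cycle_graph l =
    \<lparr> pverts = {..<l},
      parcs = {(i, j). i < l \<and> j < l \<and> (j = Suc i mod l \<or> i = Suc j mod l)} \<rparr>"

lemma cycle_graph_2: "cycle_graph 2 = \<lparr> pverts = {0, 1}, parcs = {(0, 1), (1, 0)} \<rparr>"
  by (auto simp: cycle_graph_def less_2_cases_iff)

definition edgeless_graph :: "nat \<Rightarrow> nat pair_pre_digraph" where
  "edgeless_graph t = \<lparr> pverts = {..<t}, parcs = {} \<rparr>"

definition lex_product ::
  "'a pair_pre_digraph \<Rightarrow> 'b pair_pre_digraph \<Rightarrow> ('a \<times> 'b) pair_pre_digraph" where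
  "lex_product X Y =
    \<lparr> pverts = pverts X \<times> pverts Y,
      parcs = {((x, y), (x', y')). x \<in> pverts X \<and> x' \<in> pverts X \<and> y \<in> pverts Y \<and> y' \<in> pverts Y \<and>
        ((x, x') \<in> parcs X \<or> x = x' \<and> (y, y') \<in> parcs Y)} \<rparr>"

definition lt_cycle :: "nat \<Rightarrow> nat \<Rightarrow> (nat \<times> nat) pair_pre_digraph" where
  "lt_cycle l t = lex_product (cycle_graph l) (edgeless_graph t)"

definition bipartite :: "'a pair_pre_digraph \<Rightarrow> bool" where
  "bipartite X \<longleftrightarrow>
    (\<exists>A B. pverts X = A \<union> B \<and> A \<inter> B = {} \<and> parcs X \<subseteq> A \<times> B \<union> B \<times> A)"

text \<open>
  The bound \<open>3 \<le> k\<close> is essential: circuits of a simple graph have length at least 3, whereas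
  \<open>cycle_graph 2\<close> is a single edge and \<open>2 mod 4 = 2\<close>.
\<close>

definition has_induced_circuit :: "'a pair_pre_digraph \<Rightarrow> nat \<Rightarrow> bool" where
  "has_induced_circuit X k \<longleftrightarrow>
    3 \<le> k \<and> (\<exists>H. induced_subgraph H (with_proj X) \<and> digraph_iso H (with_proj (cycle_graph k)))"

definition balanced :: "'a pair_pre_digraph \<Rightarrow> bool" where
  "balanced X \<longleftrightarrow> bipartite X \<and> \<not> (\<exists>k. k mod 4 = 2 \<and> has_induced_circuit X k)"

end

theory Submission
  imports Defs "HOL-Library.Function_Algebras" "HOL-Algebra.FiniteProduct"
begin

text \<open>
  In an $(l,t)$-cycle two vertices with the same first coordinate are twins. An induced circuit of
  length at least 5 has no twins, so it projects injectively to $C_l$; its image is closed under taking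
  neighbours, and hence its length is $l$ (\<open>lt_cycle_hole_length\<close>). Since \<open>l\<close> is 2 or divisible by 4,
  induced circuits of length 2 modulo 4 do not occur.

  For the converse, write the group additively, let \<open>K\<close> be the group of periods of \<open>S\<close>, and let
  \<open>common d\<close> be $S \cap (S+d)$, the common neighbours of 0 and \<open>d\<close>. Everything rests on one induced
  hexagon \<open>0, c, d, b, z, a\<close> (\<open>hexagon\<close>): if \<open>a\<close> is adjacent to 0 but not to \<open>d\<close>, and \<open>b\<close> to \<open>d\<close> but not to 0,
  then every common neighbour \<open>z\<close> of \<open>a\<close> and \<open>b\<close> is adjacent to all of \<open>common d\<close>. Choose \<open>d\<close> outside
  \<open>K\<close> with \<open>common d\<close> maximal under inclusion. Such a \<open>z\<close> would have \<open>a\<close> together with \<open>common d\<close> in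
  \<open>common z\<close>, against maximality; so \<open>a\<close> and \<open>b\<close> have no common neighbour. Applied to the lower end \<open>a\<close>
  of one maximal progression with difference \<open>d\<close> in \<open>S\<close>, and to \<open>b = t + d\<close> for the upper end \<open>t\<close> of
  another, this shows that all these progressions have the same length $L \ge 2$ and that sums
  $a + b - a' - b'$ of lower ends are never $nd$ with $1 \le n < 2L$ (\<open>extremal_strings\<close>).

  Let \<open>B\<close> be the set of lower ends. If \<open>B\<close> meets two cosets of \<open>K\<close>, then some difference \<open>e\<close> of elements
  of \<open>B\<close> is extremal too, and \<open>S\<close> is a union of parallelograms with sides in the directions \<open>d\<close> and \<open>e\<close>.
  The hexagon shows that they are 2 by 2 and that there is only one modulo \<open>K\<close>; then the graph modulo
  \<open>K\<close> is a quotient of the square grid, in which the boundary of a 2 by 3 rectangle is an induced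
  circuit of length 10 (\<open>no_crossing_strings_of_length_2\<close>). So \<open>B\<close> is a single coset, and modulo \<open>K\<close> the
  graph is the bipartite graph on two copies of $\mathbb{Z}/N$ in which \<open>x\<close> and \<open>y\<close> are adjacent if
  $y - x \in \{0,\dots,L-1\}$, where $N \ge 2L$. For $L \ge 3$ it contains an induced circuit of length
  $2m$ with \<open>m\<close> odd (\<open>circulant_odd_hole\<close>). Hence $L = 2$, and \<open>S\<close> is the union of the cosets of \<open>b\<close> and
  \<open>-b\<close> (\<open>connection_set_two_cosets\<close>). If \<open>l\<close> is the order of \<open>b\<close> modulo \<open>K\<close>, the graph is the
  lexicographic product of $C_l$ with $|K|$ isolated vertices. Bipartiteness makes \<open>l\<close> even; $l = 4$ would
  make $2b$ a period; and $l \equiv 2$ modulo 4 with $l \ge 6$ would make the multiples of \<open>b\<close> an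
  induced circuit.

  The central part works with a subset of the additive group of a commutative ring, so that the multiple
  $nd$ of a group element is the product \<open>of_int n * d\<close>. A finite abelian group \<open>G\<close> is reached from
  there by pulling \<open>S\<close> back along the surjection from integer-valued functions that sends \<open>c\<close>
  to the product of the powers $x^{c(x)}$ over the elements \<open>x\<close> of \<open>G\<close>. The preimage of \<open>S\<close> has the
  preimage of \<open>K\<close> as its periods, and it admits only the lengths of induced circuits that \<open>S\<close> admits,
  because induced circuits of length at least 5 have no twins and therefore survive the projection.
\<close>

section \<open>Cyclic adjacency\<close>

text \<open>
  Indices \<open>i, j < k\<close> adjacent on the circuit of length \<open>k\<close>. For \<open>k = 2\<close> both disjuncts describe the same edge.
\<close>

definition cyc_adj :: "nat \<Rightarrow> nat \<Rightarrow> nat \<Rightarrow> bool" where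
  "cyc_adj k i j \<longleftrightarrow> j = Suc i mod k \<or> i = Suc j mod k"

lemma Suc_mod_if: "i < k \<Longrightarrow> Suc i mod k = (if Suc i = k then 0 else Suc i)"
  by simp

lemma cyc_adj_dvd:
  assumes "i < k" "j < k"
  shows "cyc_adj k i j \<longleftrightarrow> int k dvd int i - int j - 1 \<or> int k dvd int i - int j + 1"
proof -
  have "b = Suc a mod k \<longleftrightarrow> int k dvd int b - int a - 1" if "a < k" "b < k" for a b
  proof -
    have "b = Suc a mod k \<longleftrightarrow> int b mod int k = (int a + 1) mod int k"
      using that by (metis mod_less of_nat_Suc of_nat_eq_iff zmod_int add.commute)
    also have "\<dots> \<longleftrightarrow> int k dvd int b - (int a + 1)" by (rule mod_eq_dvd_iff)
    finally show ?thesis by (simp add: algebra_simps)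
  qed
  from this[of i j] this[of j i] show ?thesis
    using assms dvd_minus_iff[of "int k" "int i - int j + 1"] by (auto simp: cyc_adj_def algebra_simps)
qed

text \<open>
  A twin of \<open>i\<close> is adjacent to both \<open>i + 1\<close> and \<open>i - 1\<close>, so it is \<open>i\<close>, or else it is both \<open>i + 2\<close> and
  \<open>i - 2\<close>; the latter two agree only if \<open>k\<close> divides 4.
\<close>

lemma cyc_adj_twins:
  assumes "5 \<le> k" "i < k" "j < k" and twins: "\<And>n. n < k \<Longrightarrow> cyc_adj k i n \<longleftrightarrow> cyc_adj k j n"
  shows "i = j"
proof -
  define n where "n = (if Suc i = k then 0 else Suc i)"
  define p where "p = (if i = 0 then k - 1 else i - 1)"
  have np: "n < k" "p < k" using assms by (auto simp: n_def p_def)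
  have "cyc_adj k i n" "cyc_adj k i p"
    using assms(1,2) by (auto simp: cyc_adj_def n_def p_def Suc_mod_if)
  then have "cyc_adj k j n" "cyc_adj k j p" using twins np by auto
  then show ?thesis
    using assms(1-3) np by (auto simp: cyc_adj_def Suc_mod_if n_def p_def split: if_splits)
qed


section \<open>Odd holes in circulant bipartite graphs\<close>

text \<open>
  The bipartite graph on two copies of $\mathbb{Z}/N$ with \<open>x\<close> and \<open>y\<close> adjacent if
  $y - x \in \{0,\dots,L-1\}$. Choose \<open>m\<close> points \<open>X i\<close> spread as evenly as possible around the circle, and
  put \<open>Y i\<close> at distance \<open>L - 1\<close> after \<open>X i\<close>. If all gaps between consecutive points are between 1 and
  \<open>L - 1\<close> and two consecutive gaps always add up to at least \<open>L\<close>, then \<open>Y i\<close> sees exactly \<open>X i\<close> and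
  the next point. Even spreading achieves this for $N/(L-1) \le m \le 2N/L$. This interval contains an odd
  number at least 3, except that for $L = 3$ and $N = 7$ it is $[7/2, 14/3]$ and contains only 4.
\<close>

lemma circulant_odd_hole:
  fixes L N :: nat
  assumes L: "3 \<le> L" and N: "2 * L \<le> N"
  obtains m and X Y :: "nat \<Rightarrow> int" where "odd m" "3 \<le> m"
    "\<And>i j. \<lbrakk>i < m; j < m\<rbrakk> \<Longrightarrow> (Y i - X j) mod int N < int L \<longleftrightarrow> j = i \<or> j = Suc i mod m"
proof -
  note found = that
  have main: thesis if m: "odd m" "3 \<le> m" and mL: "m * L \<le> 2 * N" and mN: "N \<le> m * (L - 1)" for m
  proof -
    define f :: "nat \<Rightarrow> nat" where "f i = (i * N) div m" for i
    have m0: "0 < m" using m by simp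
    have f1: "f i + 1 \<le> f (Suc i)" for i
    proof -
      have "m * L \<ge> m * 2" using L by (intro mult_left_mono) auto
      then have "m \<le> N" using mL by linarith
      then have "(i * N + m) div m \<le> (Suc i * N) div m" by (intro div_le_mono) simp
      moreover have "(i * N + m) div m = (i * N) div m + 1" using m0 by (intro div_add_self2) simp
      ultimately show ?thesis by (simp only: f_def)
    qed
    have mono: "f i \<le> f j" if "i \<le> j" for i j
      unfolding f_def by (intro div_le_mono mult_right_mono that) simp
    have f2: "f i + L \<le> f (i + 2)" for i
    proof -
      have "(i * N + L * m) div m \<le> ((i + 2) * N) div m" using mL by (intro div_le_mono) (simp add: algebra_simps)
      then show ?thesis using m0 by (simp add: f_def div_mult_self3)
    qed
    have f3: "f (Suc i) \<le> f i + (L - 1)" for i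
    proof -
      have "(Suc i * N) div m \<le> (i * N + (L - 1) * m) div m" using mN by (intro div_le_mono) (simp add: algebra_simps)
      then show ?thesis using m0 by (simp add: f_def div_mult_self3)
    qed
    have fm: "f (i + m) = f i + N" for i
      using m0 by (simp add: f_def algebra_simps)
    have f0: "f 0 = 0" by (simp add: f_def)
    have fN: "f i < N" if "i < m" for i
      using mono[of "Suc i" m] f1[of i] fm[of 0] f0 that by simp
    show thesis
    proof (rule found[where m = m and Y = "\<lambda>i. int (f i) + int (L - 1)" and X = "\<lambda>j. int (f j)"])
      fix i j assume ij: "i < m" "j < m"
      define D where "D = int (f i) + int (L - 1) - int (f j)"
      have bnd: "- int N < D" "D < 2 * int N"
        using fN[OF ij(1)] fN[OF ij(2)] L N by (auto simp: D_def)
      have "D mod int N < int L \<longleftrightarrow> j = i \<or> j = Suc i mod m"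
      proof -
        consider "j = i" | "j = Suc i" | "i + 2 \<le> j" | "j < i" "i = m - 1" "j = 0" | "j < i" "i + 2 \<le> j + m"
          using ij by linarith
        then show ?thesis
        proof cases
          case 1
          then show ?thesis using L N by (simp add: D_def)
        next
          case 2
          have "0 \<le> D" "D < int L" using f1[of i] f3[of i] L 2 by (auto simp: D_def)
          then have "D mod int N < int L" using N L by simp
          then show ?thesis using 2 ij by simp
        next
          case 3
          have "D < 0" using f2[of i] mono[OF 3] L by (simp add: D_def)
          then have "(D + int N) mod int N = D + int N"
            using bnd by (intro mod_pos_pos_trivial) auto
          then have "D mod int N = D + int N" by simp
          moreover have "f j \<le> f (m - 1)" using ij by (intro mono) simp
          moreover have "f (m - 1) < N" using fN m0 by simp
          ultimately have "int L \<le> D mod int N"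
            using L fN[OF ij(2)] by (simp add: D_def)
          then show ?thesis using 3 ij by auto
        next
          case 4
          have "f i + 1 \<le> N" "N \<le> f i + (L - 1)"
            using f1[of i] f3[of i] fm[of 0] f0 4 m0 by auto
          then have "D - int N < int L" "0 \<le> D - int N" "D - int N < int N"
            using 4 f0 L bnd by (auto simp: D_def)
          moreover from this have "(D - int N) mod int N = D - int N"
            by (intro mod_pos_pos_trivial) auto
          then have "D mod int N = D - int N" by simp
          ultimately show ?thesis using 4 m0 by simp
        next
          case 5
          have "f i + L \<le> f j + N" using f2[of i] mono[OF 5(2)] fm by simp
          moreover have "f j + 1 \<le> f i" using f1[of j] mono[of "Suc j" i] 5 by simp
          ultimately have "int L \<le> D" "D < int N" using L by (auto simp: D_def)
          then have "D mod int N = D" using L by simp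
          moreover have "j \<noteq> Suc i mod m"
            using 5 ij by (cases "Suc i = m") auto
          ultimately show ?thesis using \<open>int L \<le> D\<close> 5 by simp
        qed
      qed
      then show "(int (f i) + int (L - 1) - int (f j)) mod int N < int L \<longleftrightarrow> j = i \<or> j = Suc i mod m"
        by (simp add: D_def)
    qed (use m in auto)
  qed
  show thesis
  proof (cases "N = 7 \<and> L = 3")
    case True
    \<comment> \<open>The graph is the Moebius ladder with 14 vertices, with the differences 1 as its rungs;
      the circuit of length 10 below uses three rungs.\<close>
    let ?X = "[0, 5, 4, 2, 1] :: int list" and ?Y = "[0, 5, 4, 3, 1] :: int list"
    show thesis
    proof (rule found[where m = 5 and Y = "\<lambda>i. ?Y ! i" and X = "\<lambda>j. ?X ! j"])
      fix i j :: nat assume "i < 5" "j < 5"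
      then have "i = 0 \<or> i = 1 \<or> i = 2 \<or> i = 3 \<or> i = 4" "j = 0 \<or> j = 1 \<or> j = 2 \<or> j = 3 \<or> j = 4" by auto
      then show "(?Y ! i - ?X ! j) mod int N < int L \<longleftrightarrow> j = i \<or> j = Suc i mod 5"
        using True by (elim disjE; simp)
    qed auto
  next
    case False
    \<comment> \<open>\<open>q + 1\<close> is \<open>N / (L - 1)\<close> rounded up; the least odd number from there on is a valid \<open>m\<close>.\<close>
    define q where "q = (N - 1) div (L - 1)"
    define r where "r = (N - 1) mod (L - 1)"
    have "N - 1 = (L - 1) * q + r" by (simp add: q_def r_def)
    then have Nq: "N = (L - 1) * q + r + 1" using L N by linarith
    have r: "r + 1 \<le> L - 1" using L by (simp add: r_def Suc_le_eq)
    have "2 \<le> q"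
      unfolding q_def using L N by (subst le_div_geq[symmetric] | simp add: less_eq_div_iff_mult_less_eq)+
    obtain l where l: "L = l + 3" using L le_Suc_ex by (metis add.commute)
    obtain p where p: "q = p + 2" using \<open>2 \<le> q\<close> le_Suc_ex by (metis add.commute)
    show thesis
    proof (cases "even q")
      case True
      show thesis
      proof (rule main[of "q + 1"])
        show "(q + 1) * L \<le> 2 * N" unfolding Nq l p by (simp add: algebra_simps)
        show "N \<le> (q + 1) * (L - 1)" using r unfolding Nq l by (simp add: algebra_simps)
      qed (use True \<open>2 \<le> q\<close> in auto)
    next
      case odd: False
      then obtain u where u: "p = u + 1" using p by (cases p) auto
      \<comment> \<open>All three vanish exactly for \<open>L = 3\<close>, \<open>N = 7\<close>.\<close>
      have "l \<noteq> 0 \<or> r \<noteq> 0 \<or> u \<noteq> 0" using False Nq l p u by auto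
      then have "1 \<le> l * u + l + u + 2 * r" by (elim disjE) linarith+
      show thesis
      proof (rule main[of "q + 2"])
        show "(q + 2) * L \<le> 2 * N" unfolding Nq l p u using \<open>1 \<le> l * u + l + u + 2 * r\<close> by (simp add: algebra_simps)
        show "N \<le> (q + 2) * (L - 1)" using r unfolding Nq l by (simp add: algebra_simps)
      qed (use odd \<open>2 \<le> q\<close> in auto)
    qed
  qed
qed

section \<open>Connection sets without induced circuits of length 2 modulo 4\<close>

lemma mem_translate_iff:
  fixes d :: "'a::ab_group_add"
  shows "x \<in> (+) d ` A \<longleftrightarrow> x - d \<in> A"
  by (auto simp: image_iff intro!: bexI[of _ "x - d"])

text \<open>
  The Cayley graph of a balanced connection set, seen from the group: \<open>par\<close> is the bipartition, with the
  even elements forming a subgroup, and \<open>finite_translates\<close> says that \<open>S\<close> is a union of cosets of a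
  subgroup of finite index, which replaces finiteness of the group. The group is the additive group of a
  ring so that its elements have the multiples \<open>of_nat n * d\<close> and \<open>of_int n * d\<close>.
\<close>

locale balanced_connection_set =
  fixes S :: "'g::comm_ring_1 set" and par :: "'g \<Rightarrow> bool"
  assumes minus_S: "x \<in> S \<Longrightarrow> - x \<in> S"
    and par_add: "par (x + y) \<longleftrightarrow> (par x \<longleftrightarrow> par y)"
    and odd_S: "x \<in> S \<Longrightarrow> \<not> par x"
    and finite_translates: "finite (range (\<lambda>d. (+) d ` S))"
    and no_hole: "\<lbrakk>k mod 4 = 2; 6 \<le> k\<rbrakk> \<Longrightarrow> \<exists>i<k. \<exists>j<k. (v i - v j \<in> S) \<noteq> cyc_adj k i j"
begin

lemma minus_S_iff: "- x \<in> S \<longleftrightarrow> x \<in> S"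
  using minus_S by force

lemma diff_S_commute: "x - y \<in> S \<longleftrightarrow> y - x \<in> S"
  using minus_S_iff[of "x - y"] by simp

lemma par_diff: "par (x - y) \<longleftrightarrow> (par x \<longleftrightarrow> par y)"
  using par_add[of "x - y" y] by auto

text \<open>
  The form in which circuits are excluded below: the vertices alternate between \<open>x i\<close> and \<open>y i\<close>, and only
  adjacency between the two kinds has to be checked, since consecutive vertices have opposite parity
  and so vertices of the same kind have the same parity.
\<close>

lemma no_odd_alternating_hole:
  fixes x y :: "nat \<Rightarrow> 'g"
  assumes m: "odd m" "3 \<le> m"
    and adj: "\<And>i j. \<lbrakk>i < m; j < m\<rbrakk> \<Longrightarrow> y i - x j \<in> S \<longleftrightarrow> j = i \<or> j = Suc i mod m"
  shows False
proof -
  define v where "v n = (if even n then x (n div 2) else y (n div 2))" for n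
  have px: "par (x j) = par (x 0)" if "j < m" for j
    using that
  proof (induction j)
    case (Suc j)
    have "y j - x j \<in> S" "y j - x (Suc j) \<in> S"
      using adj[of j j] adj[of j "Suc j"] Suc.prems by auto
    then show ?case
      using Suc odd_S[of "y j - x j"] odd_S[of "y j - x (Suc j)"] by (auto simp: par_diff)
  qed simp
  have py: "par (y j) = (\<not> par (x 0))" if "j < m" for j
    using adj[of j j] px[OF that] that odd_S[of "y j - x j"] par_diff[of "y j" "x j"] by auto
  have k: "(2 * m) mod 4 = 2" "6 \<le> 2 * m"
    using m by presburger+
  have dbl: "(2 * i) mod (2 * m) = 2 * (i mod m)" for i
    by simp
  have sucdbl: "Suc (2 * i) mod (2 * m) = Suc (2 * i)" if "i < m" for i
    using that by simp
  have "v i - v j \<in> S \<longleftrightarrow> cyc_adj (2 * m) i j" if ij: "i < 2 * m" "j < 2 * m" for i j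
  proof -
    have xy: "x a - y b \<in> S \<longleftrightarrow> cyc_adj (2 * m) (2 * a) (Suc (2 * b))" if "a < m" "b < m" for a b
    proof -
      have "Suc (Suc (2 * b)) mod (2 * m) = 2 * (Suc b mod m)"
        using dbl[of "Suc b"] by simp
      then have "cyc_adj (2 * m) (2 * a) (Suc (2 * b)) \<longleftrightarrow> a = b \<or> a = Suc b mod m"
        unfolding cyc_adj_def using sucdbl that by auto
      then show ?thesis using adj[of b a] that diff_S_commute[of "x a" "y b"] by auto
    qed
    have sym: "cyc_adj (2 * m) a b = cyc_adj (2 * m) b a" for a b
      by (auto simp: cyc_adj_def)
    have ev: "even a \<Longrightarrow> a < 2 * m \<Longrightarrow> odd (Suc a mod (2 * m))"
      and od: "odd a \<Longrightarrow> even (Suc a mod (2 * m))" for a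
      by (simp_all add: dvd_mod_iff)
    consider (ee) "even i" "even j" | (oo) "odd i" "odd j" | (eo) "even i" "odd j" | (oe) "odd i" "even j"
      by blast
    then show ?thesis
    proof cases
      case ee
      then obtain a b where ab: "i = 2 * a" "j = 2 * b" by (auto elim!: evenE)
      then have "par (v i - v j)" using ij px[of a] px[of b] by (auto simp: v_def par_diff)
      then show ?thesis using odd_S[of "v i - v j"] ee ev[of i] ev[of j] ij by (auto simp: cyc_adj_def)
    next
      case oo
      then obtain a b where ab: "i = Suc (2 * a)" "j = Suc (2 * b)" by (auto elim!: oddE)
      then have "par (v i - v j)" using ij py[of a] py[of b] by (auto simp: v_def par_diff)
      then show ?thesis using odd_S[of "v i - v j"] oo od[of i] od[of j] by (auto simp: cyc_adj_def)
    next
      case eo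
      then obtain a b where ab: "i = 2 * a" "j = Suc (2 * b)" by (auto elim!: evenE oddE)
      then show ?thesis using ij xy[of a b] by (auto simp: v_def)
    next
      case oe
      then obtain a b where ab: "i = Suc (2 * a)" "j = 2 * b" by (auto elim!: evenE oddE)
      then show ?thesis using ij xy[of b a] diff_S_commute[of "y a" "x b"] sym[of i j] by (auto simp: v_def)
    qed
  qed
  then show False using no_hole[OF k, of v] by blast
qed

definition common :: "'g \<Rightarrow> 'g set" where
  "common d = {x \<in> S. x - d \<in> S}"

definition periods :: "'g set" where
  "periods = {k. \<forall>x. x + k \<in> S \<longleftrightarrow> x \<in> S}"

text \<open>
  The lower ends of the maximal progressions with difference \<open>d\<close> in \<open>S\<close>. As \<open>S\<close> is symmetric, the upper
  ends are their negatives.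
\<close>

definition bottoms :: "'g \<Rightarrow> 'g set" where
  "bottoms d = {a \<in> S. a - d \<notin> S}"

lemma periodsD: "k \<in> periods \<Longrightarrow> x + k \<in> S \<longleftrightarrow> x \<in> S"
  by (simp add: periods_def)

lemma periods_0: "0 \<in> periods"
  by (simp add: periods_def)

lemma periods_minus:
  assumes "k \<in> periods" shows "- k \<in> periods"
proof -
  have "x + - k \<in> S \<longleftrightarrow> x \<in> S" for x
    using assms spec[of "\<lambda>x. x + k \<in> S \<longleftrightarrow> x \<in> S" "x - k"] by (simp add: periods_def)
  then show ?thesis by (simp add: periods_def)
qed

lemma periods_add: "k \<in> periods \<Longrightarrow> l \<in> periods \<Longrightarrow> k + l \<in> periods"
  unfolding periods_def by (auto simp flip: add.assoc)

lemma periods_diff: "k \<in> periods \<Longrightarrow> l \<in> periods \<Longrightarrow> k - l \<in> periods"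
  using periods_add[of k "- l"] periods_minus by simp

lemma periodsD': "k \<in> periods \<Longrightarrow> x - k \<in> S \<longleftrightarrow> x \<in> S"
  using periodsD[OF periods_minus] by simp

lemma periodsI:
  assumes "\<And>x. x \<in> S \<Longrightarrow> x + k \<in> S" "\<And>x. x \<in> S \<Longrightarrow> x - k \<in> S"
  shows "k \<in> periods"
proof -
  have "x + k \<in> S \<longleftrightarrow> x \<in> S" for x
    using assms(1)[of x] assms(2)[of "x + k"] by auto
  then show ?thesis by (simp add: periods_def)
qed

lemma periods_translate: "(+) u ` S = (+) w ` S \<Longrightarrow> u - w \<in> periods"
proof -
  assume eq: "(+) u ` S = (+) w ` S"
  have "x + (u - w) \<in> S \<longleftrightarrow> x \<in> S" for x
    using eq mem_translate_iff[of "x + u" u S] mem_translate_iff[of "x + u" w S]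
    by (simp add: algebra_simps)
  then show ?thesis by (simp add: periods_def)
qed

text \<open>
  Among the finitely many translates of \<open>S\<close> by multiples of \<open>d\<close> two agree.
\<close>

lemma periods_multiple: obtains N where "0 < N" "of_nat N * d \<in> periods"
proof -
  have "\<not> inj (\<lambda>n::nat. (+) (of_nat n * d) ` S)"
  proof
    assume "inj (\<lambda>n::nat. (+) (of_nat n * d) ` S)"
    moreover have "range (\<lambda>n::nat. (+) (of_nat n * d) ` S) \<subseteq> range (\<lambda>d. (+) d ` S)" by auto
    ultimately show False
      using finite_translates finite_subset finite_imageD infinite_UNIV_nat by metis
  qed
  then obtain m n :: nat where mn: "m \<noteq> n" "(+) (of_nat m * d) ` S = (+) (of_nat n * d) ` S"
    by (auto simp: inj_on_def)
  have "\<exists>N>0. of_nat N * d \<in> periods"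
  proof (cases "m < n")
    case True
    then show ?thesis using periods_translate[OF mn(2)[symmetric]]
      by (intro exI[of _ "n - m"]) (auto simp: of_nat_diff algebra_simps)
  next
    case False
    then show ?thesis using periods_translate[OF mn(2)] mn(1)
      by (intro exI[of _ "m - n"]) (auto simp: of_nat_diff algebra_simps)
  qed
  then show ?thesis using that by blast
qed

text \<open>
  If \<open>z\<close> and \<open>c\<close> were not adjacent, then \<open>0, c, d, b, z, a\<close> would be an induced circuit of length 6.
\<close>

lemma hexagon:
  assumes "a \<in> S" "a - d \<notin> S" "b - d \<in> S" "b \<notin> S" "c \<in> common d" "z - a \<in> S" "z - b \<in> S"
  shows "z - c \<in> S"
proof (rule ccontr)
  assume "z - c \<notin> S"
  then have z: "c - z \<notin> S" "a - z \<in> S" "b - z \<in> S"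
    using assms diff_S_commute by blast+
  show False
  proof (rule no_odd_alternating_hole[of 3 "\<lambda>i. [c, b, a] ! i" "\<lambda>i. [0, d, z] ! i"])
    fix i j :: nat assume "i < 3" "j < 3"
    then have ij: "i = 0 \<or> i = 1 \<or> i = 2" "j = 0 \<or> j = 1 \<or> j = 2" by auto
    have c: "c \<in> S" "c - d \<in> S" using assms(5) by (auto simp: common_def)
    show "[c, b, a] ! i - [0, d, z] ! j \<in> S \<longleftrightarrow> j = i \<or> j = Suc i mod 3"
      using ij(1) ij(2)
      by (elim disjE; simp add: assms(1-4) c z)
  qed auto
qed

text \<open>
  The hexagon with \<open>a = s\<close>, \<open>b = s + d\<close> and \<open>z = s + w\<close>.
\<close>

lemma shift_by_common_differences:
  assumes "s \<in> S" "s + d \<notin> S" "s - d \<notin> S" "w \<in> common d" "c \<in> common d"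
  shows "s + w - c \<in> S"
  using hexagon[of s d "s + d" c "s + w"] assms by (auto simp: common_def)

text \<open>
  Maximality is required against all non-periods \<open>z\<close>, because in \<open>extremal_no_bridge\<close> it is applied to an
  arbitrary vertex.
\<close>

definition extremal :: "'g \<Rightarrow> bool" where
  "extremal d \<longleftrightarrow> d \<notin> periods \<and> common d \<noteq> {} \<and>
    (\<forall>z. z \<notin> periods \<longrightarrow> common d \<subseteq> common z \<longrightarrow> common z = common d)"

text \<open>
  By the hexagon, a common neighbour \<open>z\<close> of \<open>a\<close> and \<open>t + d\<close> would be adjacent to all of \<open>common d\<close>, and
  to \<open>a\<close>, which is not in \<open>common d\<close>. Maximality makes \<open>z\<close> a period, so a twin of 0; but 0 is not adjacent
  to \<open>t + d\<close>.
\<close>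

lemma extremal_no_bridge:
  assumes d: "extremal d" and a: "a \<in> bottoms d" and t: "t \<in> S" "t + d \<notin> S"
    and za: "z - a \<in> S"
  shows "z - (t + d) \<notin> S"
proof
  assume zb: "z - (t + d) \<in> S"
  have zc: "z - c \<in> S" if "c \<in> common d" for c
    using hexagon[of a d "t + d" c z] a t za zb that by (auto simp: bottoms_def)
  have sub: "common d \<subseteq> common z"
    using zc diff_S_commute[of z] by (auto simp: common_def)
  have "a \<in> common z" "a \<notin> common d"
    using a za diff_S_commute[of z a] by (auto simp: common_def bottoms_def)
  then have "z \<in> periods" using d sub unfolding extremal_def by blast
  then show False
    using zb t periodsD'[of z "t + d"] diff_S_commute by blast
qed

lemma bottoms_nonempty:
  assumes "d \<notin> periods" obtains a where "a \<in> bottoms d"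
proof -
  obtain x where "(x + d \<in> S) \<noteq> (x \<in> S)"
    using assms by (auto simp: periods_def)
  then consider "x + d \<in> S" "x \<notin> S" | "x + d \<notin> S" "x \<in> S" by blast
  then show ?thesis
  proof cases
    case 1 then show ?thesis using that[of "x + d"] by (auto simp: bottoms_def)
  next
    case 2
    then have "- x \<in> bottoms d" using minus_S_iff[of "x + d"] minus_S[of x]
      by (simp add: bottoms_def)
    then show ?thesis using that by blast
  qed
qed

text \<open>
  \<open>S\<close> consists of progressions with difference \<open>d\<close>, all of the same length \<open>L\<close>. The last clause says that
  the lower ends are in general position with respect to \<open>d\<close>; it is what turns coincidences between
  translated progressions into contradictions. Its range \<open>n \<le> 2 * L - 1\<close> is that of the
  numbers \<open>L + j - i\<close> with \<open>i, j < L\<close>.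
\<close>

definition strings :: "'g \<Rightarrow> nat \<Rightarrow> bool" where
  "strings d L \<longleftrightarrow> 2 \<le> L \<and>
     (\<forall>a\<in>bottoms d. (\<forall>j<L. a + of_nat j * d \<in> S) \<and> a + of_nat L * d \<notin> S) \<and>
     (\<forall>s\<in>S. \<exists>j<L. s - of_nat j * d \<in> bottoms d) \<and>
     (\<forall>a\<in>bottoms d. \<forall>b\<in>bottoms d. \<forall>a'\<in>bottoms d. \<forall>b'\<in>bottoms d. \<forall>n. 1 \<le> n \<and> n \<le> 2 * L - 1 \<longrightarrow>
        a + b - a' - b' \<noteq> of_nat n * d)"

text \<open>
  For lower ends \<open>a\<close>, \<open>a'\<close> the upper end of the progression of \<open>a'\<close> is \<open>a' + (len a' - 1) d\<close>, so
  \<open>extremal_no_bridge\<close> says that \<open>a - a' - (len a') d\<close> is no difference of elements of \<open>S\<close> (\<open>key\<close>).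
  With \<open>a = a'\<close> the multiple \<open>(len a) d\<close> is no such difference, so no progression is longer than another
  one. Neither is a progression unbounded below, nor of length 1, because \<open>d\<close> itself is a difference
  of elements of \<open>S\<close>. Varying the two elements of \<open>S\<close> along their progressions gives the last clause.
\<close>

lemma extremal_strings:
  assumes d: "extremal d" obtains L where "strings d L"
proof -
  obtain N where N: "0 < N" "of_nat N * d \<in> periods" by (rule periods_multiple)
  obtain a where a: "a \<in> bottoms d" using bottoms_nonempty d by (auto simp: extremal_def)
  define len where "len a = (LEAST n. a + of_nat n * d \<notin> S)" for a
  have bnd: "a + of_nat (N - 1) * d \<notin> S" if "a \<in> bottoms d" for a
  proof -
    have eq: "a + of_nat (N - 1) * d = a - d + of_nat N * d"
      using N(1) by (simp add: of_nat_diff algebra_simps)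
    show ?thesis unfolding eq using periodsD[OF N(2), of "a - d"] that by (auto simp: bottoms_def)
  qed
  have len1: "a + of_nat (len a) * d \<notin> S" if "a \<in> bottoms d" for a
    unfolding len_def by (rule LeastI[of _ "N - 1"]) (rule bnd[OF that])
  have len2: "a + of_nat j * d \<in> S" if "j < len a" for a j
    using not_less_Least[OF that[unfolded len_def]] by blast
  have len0: "1 \<le> len a" if "a \<in> bottoms d" for a
    using len1[OF that] that by (cases "len a") (auto simp: bottoms_def)
  have key: "a - a' - of_nat (len a') * d \<noteq> s - s'" if "a \<in> bottoms d" "a' \<in> bottoms d" "s \<in> S" "s' \<in> S" for a a' s s'
  proof
    assume eq: "a - a' - of_nat (len a') * d = s - s'"
    define t where "t = a' + of_nat (len a' - 1) * d"
    have t: "t \<in> S" "t + d = a' + of_nat (len a') * d"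
      using len0[OF that(2)] len2[of "len a' - 1" a'] by (auto simp: t_def of_nat_diff algebra_simps)
    have "a - t - d = s - s'" using eq t(2) by (simp add: algebra_simps)
    then have "a + s' - (t + d) = s" by (simp add: algebra_simps)
    then show False
      using extremal_no_bridge[OF d that(1) t(1), of "a + s'"] that t(2) len1[OF that(2)] by auto
  qed
  have eqlen: "len a' = len a" if "a \<in> bottoms d" "a' \<in> bottoms d" for a a'
  proof -
    have "\<not> len a < len a'" if "a \<in> bottoms d" "a' \<in> bottoms d" for a a'
      using key[of a a a' "a' + of_nat (len a) * d"] len2[of "len a" a'] that by (auto simp: bottoms_def)
    then show ?thesis using that by (meson linorder_neqE_nat)
  qed
  define L where "L = len a"
  have L: "len b = L" if "b \<in> bottoms d" for b using eqlen[OF a that] by (simp add: L_def)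
  have down: "\<exists>j<L. s - of_nat j * d \<in> bottoms d" if s: "s \<in> S" for s
  proof -
    define P where "P n \<longleftrightarrow> s - of_nat n * d \<notin> S" for n
    have ex: "\<exists>n. P n"
    proof (rule ccontr)
      assume "\<nexists>n. P n"
      then have all: "s - of_nat n * d \<in> S" for n by (simp add: P_def)
      have "a + s - (s - of_nat L * d) = a + of_nat L * d" by (simp add: algebra_simps)
      then show False
        using key[OF a a all[of L] s] by (simp add: L_def)
    qed
    define n where "n = (LEAST n. P n)"
    have n: "P n" unfolding n_def using ex by (rule LeastI_ex)
    have n': "\<not> P j" if "j < n" for j using that unfolding n_def by (rule not_less_Least)
    have "n \<noteq> 0"
    proof
      assume "n = 0" then show False using n s by (simp add: P_def)
    qed
    then have b: "s - of_nat (n - 1) * d \<in> bottoms d"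
      using n n'[of "n - 1"] by (simp add: P_def bottoms_def of_nat_diff algebra_simps)
    have "\<not> L \<le> n - 1"
    proof
      assume le: "L \<le> n - 1"
      then obtain r where r: "n - 1 = L + r" using le_Suc_ex by blast
      then have "s - of_nat r * d \<in> S" using n'[of r] \<open>n \<noteq> 0\<close> by (simp add: P_def)
      moreover have "s - of_nat r * d = s - of_nat (n - 1) * d + of_nat L * d"
        unfolding r by (simp add: algebra_simps)
      ultimately show False using len1[OF b] L[OF b] by simp
    qed
    then show ?thesis using b by (meson linorder_not_le)
  qed
  have L2: "2 \<le> L"
  proof (rule ccontr)
    assume "\<not> 2 \<le> L"
    then have "L = 1" using len0[OF a] by (simp add: L_def)
    obtain c where "c \<in> common d" using d by (auto simp: extremal_def)
    then show False using key[OF a a, of "c - d" c] \<open>L = 1\<close> by (auto simp: common_def L_def)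
  qed
  have sep: "a + b - a' - b' \<noteq> of_nat n * d"
    if ab: "a \<in> bottoms d" "b \<in> bottoms d" "a' \<in> bottoms d" "b' \<in> bottoms d" and n: "1 \<le> n" "n \<le> 2 * L - 1" for a b a' b' n
  proof
    assume eq: "a + b - a' - b' = of_nat n * d"
    obtain j j' where j: "j < L" "j' < L" "n + j' = L + j"
    proof (cases "n \<le> L")
      case True then show ?thesis using that[of 0 "L - n"] n by auto
    next
      case False then show ?thesis using that[of "n - L" 0] n by auto
    qed
    have n': "of_nat n * d = of_nat L * d + of_nat j * d - of_nat j' * d"
      using arg_cong[OF j(3), of "\<lambda>n. of_nat n * d"] by (simp add: algebra_simps)
    have "a - a' - of_nat L * d = (a + b - a' - b') - b + b' - of_nat L * d"
      by (simp add: algebra_simps)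
    then have "a - a' - of_nat L * d = (b' + of_nat j * d) - (b + of_nat j' * d)"
      unfolding eq n' by (simp add: algebra_simps)
    moreover have "b' + of_nat j * d \<in> S" "b + of_nat j' * d \<in> S"
      using ab j len2 L by auto
    ultimately show False using key[OF ab(1,3)] L[OF ab(3)] by metis
  qed
  have "strings d L"
    unfolding strings_def
    unfolding strings_def
  proof (intro conjI ballI allI impI)
    fix b assume b: "b \<in> bottoms d"
    show "b + of_nat L * d \<notin> S" using len1[OF b] L[OF b] by simp
    show "b + of_nat j * d \<in> S" if "j < L" for j using len2[of j b] L[OF b] that by simp
  qed (use L2 down sep in auto)
  then show ?thesis by (rule that)
qed

lemma stringsD:
  assumes "strings d L"
  shows strings_ge_2: "2 \<le> L"
    and strings_up: "\<lbrakk>a \<in> bottoms d; j < L\<rbrakk> \<Longrightarrow> a + of_nat j * d \<in> S"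
    and strings_stop: "a \<in> bottoms d \<Longrightarrow> a + of_nat L * d \<notin> S"
    and strings_down: "s \<in> S \<Longrightarrow> \<exists>j<L. s - of_nat j * d \<in> bottoms d"
    and strings_separated: "\<lbrakk>a \<in> bottoms d; b \<in> bottoms d; a' \<in> bottoms d; b' \<in> bottoms d; 1 \<le> n; n \<le> 2 * L - 1\<rbrakk>
      \<Longrightarrow> a + b - a' - b' \<noteq> of_nat n * d"
  using assms unfolding strings_def by blast+

lemma bottoms_periodic: "k \<in> periods \<Longrightarrow> a + k \<in> bottoms d \<longleftrightarrow> a \<in> bottoms d"
  using periodsD[of k a] periodsD[of k "a - d"] by (simp add: bottoms_def algebra_simps)

text \<open>
  The difference \<open>b - b'\<close> maps the string of \<open>a\<close> to a shifted string. If it met another string of \<open>S\<close>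
  out of phase, the phase would be a small multiple of \<open>d\<close> that is a combination of four lower ends.
\<close>

lemma bottom_difference_closed:
  assumes L: "strings d L" and b: "b \<in> bottoms d" "b' \<in> bottoms d" "a \<in> bottoms d"
    and s: "a + (b - b') \<in> S"
  shows "a + (b - b') \<in> bottoms d"
proof -
  obtain j where j: "j < L" "a + (b - b') - of_nat j * d \<in> bottoms d"
    using strings_down[OF L s] by blast
  have "a + b - b' - (a + (b - b') - of_nat j * d) = of_nat j * d" by (simp add: algebra_simps)
  then have "j = 0" using strings_separated[OF L b(3,1,2) j(2), of j] j(1) by linarith
  then show ?thesis using j by simp
qed

text \<open>
  Inside \<open>S\<close>, steps \<open>e\<close> lead from lower ends of \<open>d\<close>-strings to lower ends of \<open>d\<close>-strings. With
  \<open>strings d L\<close> and \<open>strings e M\<close> this makes \<open>S\<close> a union of \<open>L\<close> by \<open>M\<close> parallelograms, whose lowest corners are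
  the common elements of \<open>bottoms d\<close> and \<open>bottoms e\<close>.
\<close>

definition crossing :: "'g \<Rightarrow> 'g \<Rightarrow> bool" where
  "crossing d e \<longleftrightarrow> (\<forall>b\<in>bottoms d. (b + e \<in> S \<longrightarrow> b + e \<in> bottoms d) \<and> (b - e \<in> S \<longrightarrow> b - e \<in> bottoms d))"

text \<open>
  For the step \<open>- d\<close> the assumption is applied to a negative, which turns upper ends into lower ends.
\<close>

lemma crossing_commute:
  assumes "crossing d e" shows "crossing e d"
  unfolding crossing_def
proof (intro ballI conjI impI)
  fix a assume a: "a \<in> bottoms e"
  show "a + d \<in> bottoms e" if s: "a + d \<in> S"
  proof (rule ccontr)
    assume "a + d \<notin> bottoms e"
    then have "a + d - e \<in> bottoms d" using s a by (auto simp: bottoms_def algebra_simps)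
    then have "a + d \<in> bottoms d" using assms s unfolding crossing_def by force
    then show False using a by (simp add: bottoms_def)
  qed
  show "a - d \<in> bottoms e" if s: "a - d \<in> S"
  proof (rule ccontr)
    assume "a - d \<notin> bottoms e"
    then have "d + e - a \<in> bottoms d"
      using s a minus_S_iff[of "a - d - e"] minus_S_iff[of "a - e"]
      by (auto simp: bottoms_def algebra_simps)
    moreover have "d + e - a - e \<in> S" using s minus_S_iff[of "a - d"] by (simp add: algebra_simps)
    ultimately have "d + e - a - e \<in> bottoms d" using assms unfolding crossing_def by blast
    then show False using a minus_S_iff[of a] by (simp add: bottoms_def algebra_simps)
  qed
qed

lemma crossing_up:
  assumes "crossing d e" "strings e M" "b \<in> bottoms d" "b \<in> bottoms e" "j < M"
  shows "b + of_nat j * e \<in> bottoms d"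
  using assms(5)
proof (induction j)
  case (Suc j)
  then have "b + of_nat j * e \<in> bottoms d" by simp
  moreover have "b + of_nat j * e + e \<in> S"
    using strings_up[OF assms(2,4) Suc.prems] by (simp add: algebra_simps)
  ultimately have "b + of_nat j * e + e \<in> bottoms d" using assms(1) unfolding crossing_def by blast
  then show ?case by (simp add: algebra_simps)
qed (use assms in simp)

lemma crossing_down:
  assumes "crossing d e" "strings e M" "a \<in> bottoms d"
  obtains j where "j < M" "a - of_nat j * e \<in> bottoms d" "a - of_nat j * e \<in> bottoms e"
proof -
  obtain j where j: "j < M" "a - of_nat j * e \<in> bottoms e"
    using strings_down[OF assms(2)] assms(3) by (auto simp: bottoms_def)
  have "a - of_nat i * e \<in> bottoms d" if "i \<le> j" for i
    using that
  proof (induction i)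
    case (Suc i)
    obtain r where r: "j = Suc i + r" using Suc.prems le_Suc_ex by blast
    have "a - of_nat j * e + of_nat r * e \<in> S"
      using j r by (intro strings_up[OF assms(2)]) auto
    then have "a - of_nat i * e - e \<in> S" by (simp add: r algebra_simps)
    moreover have "a - of_nat i * e \<in> bottoms d" using Suc by simp
    ultimately have "a - of_nat i * e - e \<in> bottoms d" using assms(1) unfolding crossing_def by blast
    then show ?case by (simp add: algebra_simps)
  qed (use assms in simp)
  then show ?thesis using that j by blast
qed

lemma crossing_corner:
  assumes "crossing d e" "strings d L" "strings e M" "s \<in> S"
  obtains i j where "i < L" "j < M" "s - of_nat i * d - of_nat j * e \<in> bottoms d \<inter> bottoms e"
proof -
  obtain i where i: "i < L" "s - of_nat i * d \<in> bottoms d" using strings_down[OF assms(2,4)] by blast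
  then show ?thesis using crossing_down[OF assms(1,3) i(2)] that by blast
qed

text \<open>
  If \<open>L\<close> were at least 3, two common neighbours of 0 and the diagonal \<open>d + e\<close> would differ by \<open>d\<close>. The
  corner \<open>s\<close> of the parallelogram at the lower end in direction \<open>d\<close> and the upper end in direction \<open>e\<close> leaves
  \<open>S\<close> along the diagonal both ways, so \<open>shift_by_common_differences\<close> would put \<open>s - d\<close> into \<open>S\<close>.
\<close>

lemma crossing_length:
  assumes cr: "crossing d e" and L: "strings d L" and M: "strings e M"
    and b: "b \<in> bottoms d" "b \<in> bottoms e"
  shows "L = 2"
proof (rule ccontr)
  assume "L \<noteq> 2"
  then have L3: "3 \<le> L" using strings_ge_2[OF L] by simp
  note cr' = crossing_commute[OF cr] and M2 = strings_ge_2[OF M]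
  have be: "b + of_nat i * d \<in> bottoms e" if "i < L" for i
    using crossing_up[OF cr' L b(2,1) that] .
  have bd: "b + of_nat j * e \<in> bottoms d" if "j < M" for j
    using crossing_up[OF cr M b that] .
  have gr: "b + of_nat i * d + of_nat j * e \<in> S" if "i < L" "j < M" for i j
    using strings_up[OF M be] that by blast
  define s where "s = b + of_nat (M - 1) * e"
  have s: "s \<in> S" "s - d \<notin> S" using bd[of "M - 1"] M2 by (auto simp: s_def bottoms_def)
  have eq: "s + (d + e) = (b + of_nat 1 * d) + of_nat M * e"
    using M2 by (simp add: s_def of_nat_diff algebra_simps)
  have 1: "s + (d + e) \<notin> S" unfolding eq using strings_stop[OF M be[of 1]] L3 by simp
  have eq': "s - (d + e) = (b + of_nat (M - 2) * e) - d"
    using M2 by (simp add: s_def of_nat_diff algebra_simps)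
  have 2: "s - (d + e) \<notin> S" unfolding eq' using bd[of "M - 2"] M2 by (simp add: bottoms_def)
  have w: "b + of_nat 2 * d + of_nat 1 * e \<in> common (d + e)" "b + of_nat 1 * d + of_nat 1 * e \<in> common (d + e)"
    using gr[of 2 1] gr[of 1 1] gr[of 1 0] gr[of 0 0] L3 M2 by (auto simp: common_def algebra_simps)
  have "s + (b + of_nat 1 * d + of_nat 1 * e) - (b + of_nat 2 * d + of_nat 1 * e) \<in> S"
    by (rule shift_by_common_differences[OF s(1) 1 2 w(2,1)])
  then show False using s by (simp add: algebra_simps)
qed

text \<open>
  The last clause of \<open>strings\<close> for combinations of two lower ends. A period is absorbed into one of the
  lower ends, and the bound 2 on \<open>q\<close> comes from having four of them.
\<close>

lemma bottoms_combination_nonperiod: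
  assumes L: "strings d L" and b: "b \<in> bottoms d" "c \<in> bottoms d"
    and p: "\<bar>p\<bar> \<le> int (2 * L - 1)" and q: "\<bar>q\<bar> \<le> 2"
    and per: "of_int p * d + of_int q * (c - b) \<in> periods"
  shows "p = 0"
proof -
  have pos: "\<not> 0 < p" if p: "\<bar>p\<bar> \<le> int (2 * L - 1)" and q: "\<bar>q\<bar> \<le> 2"
    and per: "of_int p * d + of_int q * (c - b) \<in> periods" for p q
  proof
    assume "0 < p"
    define n where "n = nat p"
    have n: "p = int n" "1 \<le> n" "n \<le> 2 * L - 1" using \<open>0 < p\<close> p by (auto simp: n_def)
    define k where "k = of_int p * d + of_int q * (c - b)"
    have nd: "of_nat n * d = k - of_int q * (c - b)" by (simp add: k_def n)
    have k: "k \<in> periods" using per by (simp add: k_def)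
    have bk: "b + k \<in> bottoms d" "c + k \<in> bottoms d" using b bottoms_periodic[OF k] by auto
    note sep = strings_separated[OF L _ _ _ _ n(2,3), unfolded nd]
    have "q \<in> {-2, -1, 0, 1, 2}" using q by auto
    then show False
      using sep[OF bk(2) b(2) b(1) b(1)] sep[OF bk(2) b(1) b(1) b(1)] sep[OF bk(1) b(1) b(1) b(1)]
        sep[OF bk(1) b(1) b(2) b(1)] sep[OF bk(1) b(1) b(2) b(2)]
      by (auto simp: algebra_simps)
  qed
  have "- (of_int p * d + of_int q * (c - b)) \<in> periods" using per by (rule periods_minus)
  then have "of_int (- p) * d + of_int (- q) * (c - b) \<in> periods" by (simp add: algebra_simps)
  then have "\<not> 0 < - p" using pos[of "- p" "- q"] p q by simp
  moreover have "\<not> 0 < p" using pos p q per by blast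
  ultimately show "p = 0" by simp
qed

section \<open>Two crossing families of strings\<close>

lemma unit_parallelogram:
  assumes cr: "crossing d e" and d: "strings d 2" and e: "strings e 2"
    and c: "c \<in> bottoms d" "c \<in> bottoms e"
  shows "c + e \<in> bottoms d" "c + d \<in> bottoms e"
    "c + d + e \<in> S" "c + d \<in> S" "c + e \<in> S" "c \<in> S"
proof -
  show ce: "c + e \<in> bottoms d" and cd: "c + d \<in> bottoms e"
    using crossing_up[OF cr e c, of 1] crossing_up[OF crossing_commute[OF cr] d c(2,1), of 1] by auto
  show "c + d + e \<in> S" using strings_up[OF e cd, of 1] by simp
  show "c + d \<in> S" "c + e \<in> S" "c \<in> S" using ce cd c by (auto simp: bottoms_def)
qed

text \<open>
  The vertex \<open>c + d\<close> leaves \<open>S\<close> along the diagonal \<open>d + e\<close> both ways, while every corner translated by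
  \<open>d + e\<close> is a common neighbour of 0 and \<open>d + e\<close>. So \<open>c + d + (c1 - c2)\<close> is in \<open>S\<close>, and the general
  position of lower ends makes it the upper element of its \<open>d\<close>-string.
\<close>

lemma corner_shift:
  assumes cr: "crossing d e" and d: "strings d 2" and e: "strings e 2"
    and c: "c \<in> bottoms d" "c \<in> bottoms e"
    and c1: "c1 \<in> bottoms d" "c1 \<in> bottoms e" and c2: "c2 \<in> bottoms d" "c2 \<in> bottoms e"
  shows "c + (c1 - c2) \<in> bottoms d"
proof -
  note up = unit_parallelogram[OF cr d e]
  have com: "c' + (d + e) \<in> common (d + e)" if "c' \<in> bottoms d" "c' \<in> bottoms e" for c'
    using up[OF that] by (simp add: common_def algebra_simps)
  have "c + d + (d + e) \<notin> S" using strings_stop[OF d up(1)[OF c]] by (simp add: algebra_simps)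
  moreover have "c + d - (d + e) \<notin> S" using c by (simp add: bottoms_def algebra_simps)
  ultimately have "c + d + (c1 + (d + e)) - (c2 + (d + e)) \<in> S"
    by (rule shift_by_common_differences[OF up(4)[OF c] _ _ com[OF c1] com[OF c2]])
  then have "c + d + (c1 - c2) \<in> S" by (simp add: algebra_simps)
  then obtain j where j: "j < 2" "c + d + (c1 - c2) - of_nat j * d \<in> bottoms d"
    using strings_down[OF d] by blast
  have "j \<noteq> 0"
  proof
    assume "j = 0"
    then have "(c + d + (c1 - c2)) + c2 - c - c1 \<noteq> of_nat 1 * d"
      using j by (intro strings_separated[OF d _ c2(1) c(1) c1(1)]) auto
    then show False by (simp add: algebra_simps)
  qed
  then have "j = 1" using j by simp
  then show ?thesis using j by (simp add: algebra_simps)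
qed

text \<open>
  By \<open>corner_shift\<close> all corners are congruent modulo periods, so \<open>S\<close> is
  \<open>b, b + d, b + e, b + d + e\<close> modulo periods, that is \<open>p, -p, q, -q\<close> with \<open>p = b + d + e\<close> and
  \<open>q = b + d\<close>. The graph modulo periods is a quotient of the square grid with unit steps \<open>p\<close> and \<open>q\<close>.
  Here \<open>d\<close> and \<open>e\<close> are the diagonals \<open>p + q\<close> and \<open>p - q\<close>. By \<open>nonper\<close> no short combination of \<open>d\<close> and \<open>e\<close> is
  a period, and so the boundary of a 2 by 3 rectangle of the grid remains induced.
\<close>

lemma no_crossing_strings_of_length_2:
  assumes cr: "crossing d e" and d: "strings d 2" and e: "strings e 2"
    and b: "b \<in> bottoms d" "b \<in> bottoms e"
  shows False
proof -
  note cr' = crossing_commute[OF cr]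
  note up = unit_parallelogram[OF cr d e]
  have shifted: "c + (c1 - c2) \<in> bottoms d" "c + (c1 - c2) \<in> bottoms e"
    if "c \<in> bottoms d" "c \<in> bottoms e" "c1 \<in> bottoms d" "c1 \<in> bottoms e" "c2 \<in> bottoms d" "c2 \<in> bottoms e" for c c1 c2
    using corner_shift[OF cr d e] corner_shift[OF cr' e d] that by blast+
  have S_shift: "x + (c1 - c2) \<in> S"
    if x: "x \<in> S" and c: "c1 \<in> bottoms d" "c1 \<in> bottoms e" "c2 \<in> bottoms d" "c2 \<in> bottoms e" for x c1 c2
  proof -
    obtain i j where ij: "i < 2" "j < 2" "x - of_nat i * d - of_nat j * e \<in> bottoms d \<inter> bottoms e"
      by (rule crossing_corner[OF cr d e x])
    define c where "c = x - of_nat i * d - of_nat j * e + (c1 - c2)"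
    have "c \<in> bottoms d" "c \<in> bottoms e" using shifted ij(3) c by (auto simp: c_def)
    note up = up[OF this]
    have "x + (c1 - c2) = c + of_nat i * d + of_nat j * e" by (simp add: c_def algebra_simps)
    moreover have "(i = 0 \<or> i = 1) \<and> (j = 0 \<or> j = 1)" using ij by auto
    ultimately show ?thesis using up by auto
  qed
  have corner_period: "c1 - c2 \<in> periods"
    if c: "c1 \<in> bottoms d" "c1 \<in> bottoms e" "c2 \<in> bottoms d" "c2 \<in> bottoms e" for c1 c2
  proof (rule periodsI)
    show "x + (c1 - c2) \<in> S" if "x \<in> S" for x using S_shift[OF that c] .
    show "x - (c1 - c2) \<in> S" if "x \<in> S" for x
      using S_shift[OF that c(3,4,1,2)] by (simp add: algebra_simps)
  qed
  have nonper: "p = 0 \<and> q = 0"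
    if "of_int p * d + of_int q * e \<in> periods" "\<bar>p\<bar> \<le> 3" "\<bar>q\<bar> \<le> 3" "\<bar>p\<bar> \<le> 2 \<or> \<bar>q\<bar> \<le> 2" for p q
  proof -
    have 1: "p = 0" if "of_int p * d + of_int q * e \<in> periods" "\<bar>p\<bar> \<le> 3" "\<bar>q\<bar> \<le> 2" for p q
      using bottoms_combination_nonperiod[OF d b(1) up(1)[OF b], of p q] that by simp
    have 2: "q = 0" if "of_int p * d + of_int q * e \<in> periods" "\<bar>q\<bar> \<le> 3" "\<bar>p\<bar> \<le> 2" for p q
      using bottoms_combination_nonperiod[OF e b(2) up(2)[OF b], of q p] that by (simp add: add.commute)
    show ?thesis
    proof (cases "\<bar>q\<bar> \<le> 2")
      case True
      then have "p = 0" using 1 that by blast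
      then show ?thesis using 2[of p q] that by simp
    next
      case False
      then have "q = 0" using 2[of p q] that by blast
      then show ?thesis using False by simp
    qed
  qed
  have mem: "b + of_int u * d + of_int v * e \<in> S \<longleftrightarrow> (u = 0 \<or> u = 1) \<and> (v = 0 \<or> v = 1)"
    if uv: "-2 \<le> u" "u \<le> 3" "-2 \<le> v" "v \<le> 3" "-1 \<le> u \<and> u \<le> 2 \<or> -1 \<le> v \<and> v \<le> 2" for u v
  proof
    assume "b + of_int u * d + of_int v * e \<in> S"
    then obtain i j where ij: "i < 2" "j < 2"
      "b + of_int u * d + of_int v * e - of_nat i * d - of_nat j * e \<in> bottoms d \<inter> bottoms e"
      by (rule crossing_corner[OF cr d e])
    have "(b + of_int u * d + of_int v * e - of_nat i * d - of_nat j * e) - b \<in> periods"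
      using corner_period[OF _ _ b] ij(3) by blast
    then have "of_int (u - int i) * d + of_int (v - int j) * e \<in> periods" by (simp add: algebra_simps)
    then have "u - int i = 0 \<and> v - int j = 0" using ij uv by (intro nonper) auto
    then show "(u = 0 \<or> u = 1) \<and> (v = 0 \<or> v = 1)" using ij by auto
  next
    assume "(u = 0 \<or> u = 1) \<and> (v = 0 \<or> v = 1)"
    then show "b + of_int u * d + of_int v * e \<in> S" using up[OF b] by auto
  qed
  \<comment> \<open>The boundary of the rectangle in the coordinates \<open>d\<close>, \<open>e\<close>: the even points \<open>i p + j q\<close> are
    \<open>((i + j) / 2, (i - j) / 2)\<close>, and the odd ones are \<open>((i + j + 1) / 2, (i - j + 1) / 2)\<close> relative to \<open>b\<close>.\<close>
  let ?xu = "[0, 1, 2, 2, 1] :: int list" and ?xv = "[0, 1, 0, -1, -1] :: int list"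
  let ?yu = "[1, 2, 3, 2, 1] :: int list" and ?yv = "[1, 1, 0, -1, 0] :: int list"
  show False
  proof (rule no_odd_alternating_hole[of 5 "\<lambda>i. b + of_int (?yu ! i) * d + of_int (?yv ! i) * e"
        "\<lambda>i. of_int (?xu ! i) * d + of_int (?xv ! i) * e"])
    fix i j :: nat assume "i < 5" "j < 5"
    then have ij: "i = 0 \<or> i = 1 \<or> i = 2 \<or> i = 3 \<or> i = 4" "j = 0 \<or> j = 1 \<or> j = 2 \<or> j = 3 \<or> j = 4" by auto
    have eq: "b + of_int (?yu ! i) * d + of_int (?yv ! i) * e - (of_int (?xu ! j) * d + of_int (?xv ! j) * e)
        = b + of_int (?yu ! i - ?xu ! j) * d + of_int (?yv ! i - ?xv ! j) * e"
      by (simp only: of_int_diff algebra_simps)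
    have "b + of_int (?yu ! i - ?xu ! j) * d + of_int (?yv ! i - ?xv ! j) * e \<in> S
      \<longleftrightarrow> (?yu ! i - ?xu ! j = 0 \<or> ?yu ! i - ?xu ! j = 1) \<and> (?yv ! i - ?xv ! j = 0 \<or> ?yv ! i - ?xv ! j = 1)"
      by (rule mem) (use ij in \<open>elim disjE; simp\<close>)+
    moreover have "(?yu ! i - ?xu ! j = 0 \<or> ?yu ! i - ?xu ! j = 1) \<and> (?yv ! i - ?xv ! j = 0 \<or> ?yv ! i - ?xv ! j = 1)
      \<longleftrightarrow> j = i \<or> j = Suc i mod 5"
      using ij by (elim disjE; simp)
    ultimately show "b + of_int (?yu ! i) * d + of_int (?yv ! i) * e - (of_int (?xu ! j) * d + of_int (?xv ! j) * e) \<in> S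
      \<longleftrightarrow> j = i \<or> j = Suc i mod 5"
      unfolding eq by (rule trans)
  qed auto
qed

lemma common_translate: "common d = S \<inter> (+) d ` S"
  by (auto simp: common_def mem_translate_iff)

lemma finite_range_common: "finite (range common)"
proof -
  have "range common = (\<inter>) S ` range (\<lambda>d. (+) d ` S)"
    by (simp add: image_image common_translate)
  then show ?thesis using finite_translates by simp
qed

lemma maximal_common:
  assumes "D \<noteq> {}"
  obtains d where "d \<in> D" "\<And>z. \<lbrakk>z \<in> D; common d \<subseteq> common z\<rbrakk> \<Longrightarrow> common z = common d"
proof -
  have "finite (common ` D)" using finite_range_common by (rule finite_subset[rotated]) auto
  then obtain C where C: "C \<in> common ` D" "\<And>A. A \<in> common ` D \<Longrightarrow> C \<subseteq> A \<Longrightarrow> C = A"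
    using finite_has_maximal[of "common ` D"] assms by (metis image_is_empty)
  then obtain d where "d \<in> D" "C = common d" by blast
  then show ?thesis using that C(2) by (metis imageI)
qed

text \<open>
  Choose \<open>e\<close> with \<open>common e\<close> maximal among the differences of lower ends only. It is then maximal among
  all elements: \<open>common e\<close> contains a full \<open>d\<close>-string, and if \<open>common z\<close> contains it too, then
  subtracting \<open>z\<close> carries this string to a full string of \<open>S\<close>, so that \<open>z\<close> is itself a difference of
  lower ends.
\<close>

lemma extremal_bottom_difference:
  assumes L: "strings d L" and b: "b \<in> bottoms d" "b' \<in> bottoms d" "b - b' \<notin> periods"
  obtains e where "extremal e" "crossing d e"
proof -
  let ?D = "{c - c' | c c'. c \<in> bottoms d \<and> c' \<in> bottoms d} - periods"
  have "?D \<noteq> {}" using b by blast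
  then obtain e where e: "e \<in> ?D" "\<And>z. \<lbrakk>z \<in> ?D; common e \<subseteq> common z\<rbrakk> \<Longrightarrow> common z = common e"
    using maximal_common[of ?D] by blast
  then obtain c c' where c: "c \<in> bottoms d" "c' \<in> bottoms d" "e = c - c'" "e \<notin> periods" by blast
  have ce: "c + of_nat j * d \<in> common e" if "j < L" for j
    using strings_up[OF L c(1) that] strings_up[OF L c(2) that] by (simp add: common_def c(3) algebra_simps)
  have "extremal e"
    unfolding extremal_def
  proof (intro conjI allI impI)
    show "common e \<noteq> {}" using ce[of 0] strings_ge_2[OF L] by auto
    fix z assume z: "z \<notin> periods" "common e \<subseteq> common z"
    have cz: "c - z + of_nat j * d \<in> S" if "j < L" for j
      using ce[OF that] z(2) by (auto simp: common_def algebra_simps)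
    obtain j where j: "j < L" "c - z - of_nat j * d \<in> bottoms d"
      using strings_down[OF L cz[of 0]] strings_ge_2[OF L] by auto
    have "j = 0"
    proof (rule ccontr)
      assume "j \<noteq> 0"
      have eq: "c - z - of_nat j * d + of_nat L * d = c - z + of_nat (L - j) * d"
        using j(1) by (simp add: of_nat_diff algebra_simps)
      show False using strings_stop[OF L j(2)] cz[of "L - j"] \<open>j \<noteq> 0\<close> j(1) unfolding eq by simp
    qed
    then have "c - z \<in> bottoms d" using j by simp
    moreover have "z = c - (c - z)" by simp
    ultimately have "z \<in> ?D" using c(1) z(1) by blast
    then show "common z = common e" using e(2) z(2) by blast
  qed (use c in auto)
  moreover have "crossing d e"
    unfolding crossing_def
  proof (intro ballI conjI impI)
    fix a assume a: "a \<in> bottoms d"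
    show "a + e \<in> bottoms d" if "a + e \<in> S"
      using bottom_difference_closed[OF L c(1,2) a] that c(3) by simp
    show "a - e \<in> bottoms d" if "a - e \<in> S"
      using bottom_difference_closed[OF L c(2,1) a] that unfolding c(3) by (simp add: algebra_simps)
  qed
  ultimately show ?thesis by (rule that)
qed

lemma bottoms_unique_mod_periods:
  assumes d: "extremal d" and L: "strings d L" and b: "b \<in> bottoms d" "b' \<in> bottoms d"
  shows "b - b' \<in> periods"
proof (rule ccontr)
  assume "b - b' \<notin> periods"
  then obtain e where e: "extremal e" "crossing d e" by (rule extremal_bottom_difference[OF L b])
  obtain M where M: "strings e M" by (rule extremal_strings[OF e(1)])
  obtain c where c: "c \<in> bottoms d" "c \<in> bottoms e"
    using crossing_down[OF e(2) M b(1)] by blast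
  have "L = 2" by (rule crossing_length[OF e(2) L M c])
  moreover have "M = 2" by (rule crossing_length[OF crossing_commute[OF e(2)] M L c(2,1)])
  ultimately show False using no_crossing_strings_of_length_2[OF e(2) _ _ c] L M by simp
qed

lemma period_order:
  obtains N where "0 < N" "\<And>z. of_int z * d \<in> periods \<longleftrightarrow> int N dvd z"
proof -
  define N where "N = (LEAST n. 0 < n \<and> of_nat n * d \<in> periods)"
  have "\<exists>n. 0 < n \<and> of_nat n * d \<in> periods" using periods_multiple[of d] by blast
  then have N: "0 < N \<and> of_nat N * d \<in> periods" unfolding N_def by (rule LeastI_ex)
  have mult_nat: "of_nat n * (of_nat N * d) \<in> periods" for n
    by (induction n) (simp_all add: periods_0 periods_add N distrib_right)
  have mult: "of_int z * (of_nat N * d) \<in> periods" for z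
    using mult_nat periods_minus[OF mult_nat] by (cases z rule: int_cases2) auto
  have "of_int z * d \<in> periods \<longleftrightarrow> int N dvd z" for z
  proof
    assume z: "of_int z * d \<in> periods"
    define r where "r = nat (z mod int N)"
    have r: "z mod int N = int r" "r < N" using N by (auto simp: r_def nat_less_iff)
    have "of_int z * d - of_int (z div int N) * (of_nat N * d) = of_int (z - z div int N * int N) * d"
      by (simp add: algebra_simps)
    also have "z - z div int N * int N = int r" using r(1) by (simp add: minus_div_mult_eq_mod)
    finally have "of_nat r * d \<in> periods" using periods_diff[OF z mult[of "z div int N"]] by simp
    moreover have "\<not> (0 < r \<and> of_nat r * d \<in> periods)"
      using r(2) unfolding N_def by (rule not_less_Least)
    ultimately show "int N dvd z" using r(1) by (simp add: dvd_eq_mod_eq_0)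
  next
    assume "int N dvd z"
    then obtain y where "z = int N * y" by (rule dvdE)
    then show "of_int z * d \<in> periods" using mult[of y] by (simp add: algebra_simps)
  qed
  then show ?thesis using that N by blast
qed

text \<open>
  Modulo periods the vertices of either parity form a cycle of length \<open>N\<close>, the order of \<open>d\<close>, and adjacency
  is that of \<open>circulant_odd_hole\<close>.
\<close>

lemma single_string_length:
  assumes L: "strings d L" and b: "b \<in> bottoms d"
    and single: "\<And>c. c \<in> bottoms d \<Longrightarrow> c - b \<in> periods"
  shows "L = 2"
proof (rule ccontr)
  assume "L \<noteq> 2"
  then have L3: "3 \<le> L" using strings_ge_2[OF L] by simp
  have nonper: "p = 0" if "\<bar>p\<bar> \<le> int (2 * L - 1)" "of_int p * d \<in> periods" for p
    using bottoms_combination_nonperiod[OF L b b that(1), of 0] that(2) by simp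
  obtain N where N: "0 < N" "\<And>z. of_int z * d \<in> periods \<longleftrightarrow> int N dvd z"
    using period_order[of d] by blast
  have N2: "2 * L \<le> N"
  proof (rule ccontr)
    assume "\<not> 2 * L \<le> N"
    then show False using nonper[of "int N"] N(1) N(2)[of "int N"] by simp
  qed
  have mem: "b + of_int z * d \<in> S \<longleftrightarrow> z mod int N < int L" for z
  proof
    assume "b + of_int z * d \<in> S"
    then obtain j where j: "j < L" "b + of_int z * d - of_nat j * d \<in> bottoms d"
      using strings_down[OF L] by blast
    have "of_int (z - int j) * d \<in> periods" using single[OF j(2)] by (simp add: algebra_simps)
    then have "z mod int N = int j mod int N" unfolding N(2) mod_eq_dvd_iff .
    then show "z mod int N < int L" using j(1) N2 by simp
  next
    assume z: "z mod int N < int L"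
    define r where "r = nat (z mod int N)"
    have r: "r < L" "z mod int N = int r" using z N(1) by (auto simp: r_def nat_less_iff)
    have "of_int (z - int r) * d \<in> periods"
      using N(2) r(2) by (metis dvd_minus_mod)
    then have "b + of_nat r * d + of_int (z - int r) * d \<in> S"
      using periodsD strings_up[OF L b r(1)] by blast
    then show "b + of_int z * d \<in> S" by (simp add: algebra_simps)
  qed
  obtain m and X Y :: "nat \<Rightarrow> int" where m: "odd m" "3 \<le> m"
    "\<And>i j. \<lbrakk>i < m; j < m\<rbrakk> \<Longrightarrow> (Y i - X j) mod int N < int L \<longleftrightarrow> j = i \<or> j = Suc i mod m"
    using circulant_odd_hole[OF L3 N2] by metis
  show False
  proof (rule no_odd_alternating_hole[OF m(1,2), of "\<lambda>i. b + of_int (Y i) * d" "\<lambda>j. of_int (X j) * d"])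
    fix i j assume ij: "i < m" "j < m"
    have eq: "b + of_int (Y i) * d - of_int (X j) * d = b + of_int (Y i - X j) * d" by (simp add: algebra_simps)
    show "b + of_int (Y i) * d - of_int (X j) * d \<in> S \<longleftrightarrow> j = i \<or> j = Suc i mod m"
      unfolding eq mem by (rule m(3)[OF ij])
  qed
qed

text \<open>
  Either 0 has a common neighbour with its twins only, and then \<open>S\<close> is one coset, or some \<open>d\<close> is
  extremal. In the latter case \<open>S\<close> consists of \<open>b\<close> and \<open>b + d\<close> modulo periods, and \<open>- (b + d)\<close> is a lower
  end, hence congruent to \<open>b\<close>.
\<close>

theorem connection_set_two_cosets:
  assumes "S \<noteq> {}"
  obtains b where "\<And>x. x \<in> S \<longleftrightarrow> x - b \<in> periods \<or> x + b \<in> periods"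
proof -
  have two: "x \<in> S" if "b \<in> S" "x - b \<in> periods \<or> x + b \<in> periods" for x b
    using that periodsD[of "x - b" b] periodsD[of "x + b" "- b"] minus_S[of b] by auto
  let ?D = "{d. d \<notin> periods \<and> common d \<noteq> {}}"
  show ?thesis
  proof (cases "?D = {}")
    case True
    obtain b where b: "b \<in> S" using assms by blast
    have "x - b \<in> periods" if "x \<in> S" for x
    proof -
      have "x \<in> common (x - b)" using that b by (simp add: common_def)
      then show ?thesis using True by blast
    qed
    then show ?thesis using that[of b] two[OF b] by blast
  next
    case False
    then obtain d where d: "d \<in> ?D" "\<And>z. \<lbrakk>z \<in> ?D; common d \<subseteq> common z\<rbrakk> \<Longrightarrow> common z = common d"
      using maximal_common[of ?D] by blast
    then have ext: "extremal d" unfolding extremal_def by blast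
    obtain L where L: "strings d L" by (rule extremal_strings[OF ext])
    obtain b where b: "b \<in> bottoms d" using bottoms_nonempty d(1) by blast
    have single: "c - b \<in> periods" if "c \<in> bottoms d" for c
      by (rule bottoms_unique_mod_periods[OF ext L that b])
    have L2: "L = 2" by (rule single_string_length[OF L b single])
    have bS: "b \<in> S" and bd: "b + d \<in> S" and bdd: "b + d + d \<notin> S"
      using b strings_up[OF L b, of 1] strings_stop[OF L b] L2 by (auto simp: bottoms_def algebra_simps)
    have bot: "- (b + d) \<in> bottoms d"
      using minus_S[OF bd] bdd minus_S_iff[of "b + d + d"] by (simp add: bottoms_def algebra_simps)
    have "x - b \<in> periods \<or> x + b \<in> periods" if x: "x \<in> S" for x
    proof -
      obtain j where j: "j < 2" "x - of_nat j * d \<in> bottoms d" using strings_down[OF L x] L2 by blast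
      then consider "x - b \<in> periods" | "x - d - b \<in> periods"
        using single[OF j(2)] by (cases j) auto
      then show ?thesis
      proof cases
        case 2
        have "x - d - b - (- (b + d) - b) \<in> periods" using periods_diff[OF 2 single[OF bot]] .
        then show ?thesis by (simp add: algebra_simps)
      qed simp
    qed
    then show ?thesis using that[of b] two[OF bS] by blast
  qed
qed

lemma par_of_nat: "\<not> par b \<Longrightarrow> par (of_nat n * b) \<longleftrightarrow> even n"
proof (induction n)
  case 0
  then show ?case using par_add[of 0 0] by auto
next
  case (Suc n)
  then show ?case using par_add[of b "of_nat n * b"] by (simp add: algebra_simps)
qed

text \<open>
  The multiples of \<open>b\<close> form a circuit of length \<open>l\<close> modulo periods; for \<open>l \<ge> 3\<close> it is induced.
\<close>

lemma coset_multiple: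
  assumes b: "\<And>x. x \<in> S \<longleftrightarrow> x - b \<in> periods \<or> x + b \<in> periods"
    and l: "\<And>z. of_int z * b \<in> periods \<longleftrightarrow> int l dvd z"
    and ij: "i < l" "j < l"
  shows "of_nat i * b - of_nat j * b \<in> S \<longleftrightarrow> cyc_adj l i j"
proof -
  have "of_nat i * b - of_nat j * b - b = of_int (int i - int j - 1) * b"
    "of_nat i * b - of_nat j * b + b = of_int (int i - int j + 1) * b"
    by (simp_all add: algebra_simps)
  then show ?thesis unfolding cyc_adj_dvd[OF ij] b by (simp only: l)
qed

text \<open>
  Periods are even and \<open>b\<close> is odd, so \<open>l\<close> is even. For \<open>l = 4\<close> the translation by \<open>2 * b\<close> would exchange the
  cosets of \<open>b\<close> and \<open>- b\<close>, so it would preserve \<open>S\<close> and be a period, against the order of \<open>b\<close>.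
\<close>

lemma cycle_length:
  assumes b: "\<And>x. x \<in> S \<longleftrightarrow> x - b \<in> periods \<or> x + b \<in> periods"
    and l: "0 < l" "\<And>z. of_int z * b \<in> periods \<longleftrightarrow> int l dvd z"
  shows "l = 2 \<or> l mod 4 = 0 \<and> 8 \<le> l"
proof -
  have bS: "b \<in> S" by (simp add: b periods_0)
  have even_period: "par k" if "k \<in> periods" for k
    using odd_S[OF bS] odd_S[of "b + k"] periodsD[OF that, of b] bS par_add[of b k] by auto
  have "even l"
    using even_period[of "of_nat l * b"] l(2)[of "int l"] par_of_nat[of b l] odd_S[OF bS] by simp
  moreover have "l \<noteq> 4"
  proof
    assume "l = 4"
    then have 4: "4 * b \<in> periods" and 2: "2 * b \<notin> periods" using l(2)[of 4] l(2)[of 2] by auto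
    have "2 * b \<in> periods"
    proof (rule periodsI)
      fix x assume "x \<in> S"
      then consider "x - b \<in> periods" | "x + b \<in> periods" using b by blast
      then have "x + 2 * b \<in> S \<and> x - 2 * b \<in> S"
      proof cases
        case 1
        have "x + 2 * b + b \<in> periods" "x - 2 * b + b \<in> periods"
          using periods_add[OF 1 4] 1 by (simp_all add: algebra_simps)
        then show ?thesis using b by blast
      next
        case 2
        have "x + 2 * b - b \<in> periods" "x - 2 * b - b \<in> periods"
          using periods_diff[OF 2 4] 2 by (simp_all add: algebra_simps)
        then show ?thesis using b by blast
      qed
      then show "x + 2 * b \<in> S" "x - 2 * b \<in> S" by auto
    qed
    then show False using 2 by simp
  qed
  moreover have "\<not> (l mod 4 = 2 \<and> 6 \<le> l)"
    using no_hole[of l "\<lambda>i. of_nat i * b"] coset_multiple[OF b l(2)] by blast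
  ultimately show ?thesis using l(1) by presburger
qed

end

section \<open>Induced circuits and isomorphisms of graphs given by pairs\<close>

lemma digraph_isoI:
  assumes bij: "bij_betw f (pverts X) (pverts Y)"
    and wf: "parcs X \<subseteq> pverts X \<times> pverts X" "parcs Y \<subseteq> pverts Y \<times> pverts Y"
    and arcs: "\<And>u v. \<lbrakk>u \<in> pverts X; v \<in> pverts X\<rbrakk> \<Longrightarrow> (u, v) \<in> parcs X \<longleftrightarrow> (f u, f v) \<in> parcs Y"
  shows "digraph_iso (with_proj X) (with_proj Y)"
proof -
  let ?h = "\<lparr>iso_verts = f, iso_arcs = map_prod f f, iso_head = snd, iso_tail = fst\<rparr>"
  have inj: "inj_on f (pverts X)" and img: "f ` pverts X = pverts Y"
    using bij by (auto simp: bij_betw_def)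
  have "inj_on (map_prod f f) (parcs X)"
    using inj wf(1) by (intro inj_on_subset[OF map_prod_inj_on[OF inj inj]])
  then have "pre_digraph.digraph_isomorphism (with_proj X) ?h"
    unfolding pre_digraph.digraph_isomorphism_def using inj wf(1)
    by (auto simp: wf_digraph_def)
  moreover have "map_prod f f ` parcs X = parcs Y"
  proof
    show "map_prod f f ` parcs X \<subseteq> parcs Y" using arcs wf(1) by auto
    show "parcs Y \<subseteq> map_prod f f ` parcs X"
    proof
      fix e assume e: "e \<in> parcs Y"
      obtain a b where ab: "e = (a, b)" by (cases e)
      then have "a \<in> f ` pverts X" "b \<in> f ` pverts X" using e wf(2) img by auto
      then obtain u v where "u \<in> pverts X" "v \<in> pverts X" "a = f u" "b = f v" by auto
      then show "e \<in> map_prod f f ` parcs X" using arcs e ab by force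
    qed
  qed
  then have "with_proj Y = app_iso ?h (with_proj X)"
    by (simp add: app_iso_def with_proj_def img)
  ultimately show ?thesis unfolding digraph_iso_def by blast
qed

text \<open>
  The arcs of the image are determined by their ends, so the vertex map alone carries the isomorphism.
\<close>

lemma digraph_isoE:
  assumes "digraph_iso (with_proj X) (with_proj Y)"
  obtains f where "bij_betw f (pverts X) (pverts Y)"
    "\<And>u v. \<lbrakk>u \<in> pverts X; v \<in> pverts X\<rbrakk> \<Longrightarrow> (u, v) \<in> parcs X \<longleftrightarrow> (f u, f v) \<in> parcs Y"
proof -
  obtain h where h: "pre_digraph.digraph_isomorphism (with_proj X) h"
    and Y: "with_proj Y = app_iso h (with_proj X)"
    using assms unfolding digraph_iso_def by blast
  define f where "f = iso_verts h"
  have inj: "inj_on f (pverts X)" and wf: "wf_digraph (with_proj X)"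
    and ends: "\<And>a. a \<in> parcs X \<Longrightarrow> f (fst a) = iso_tail h (iso_arcs h a) \<and> f (snd a) = iso_head h (iso_arcs h a)"
    using h by (auto simp: pre_digraph.digraph_isomorphism_def f_def)
  have Y': "pverts Y = f ` pverts X" "parcs Y = iso_arcs h ` parcs X" "fst = iso_tail h" "snd = iso_head h"
    using Y by (auto simp: app_iso_def with_proj_def f_def)
  have ia: "iso_arcs h a = (f (fst a), f (snd a))" if "a \<in> parcs X" for a
    using ends[OF that] Y'(3,4) by (metis prod.collapse)
  have sub: "a \<in> pverts X \<times> pverts X" if "a \<in> parcs X" for a
    using wf_digraph.tail_in_verts[OF wf, of a] wf_digraph.head_in_verts[OF wf, of a] that
    by (cases a) auto
  show ?thesis
  proof (rule that[of f])
    show "bij_betw f (pverts X) (pverts Y)" using inj Y' by (simp add: bij_betw_def)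
    fix u v assume uv: "u \<in> pverts X" "v \<in> pverts X"
    show "(u, v) \<in> parcs X \<longleftrightarrow> (f u, f v) \<in> parcs Y"
    proof
      assume "(u, v) \<in> parcs X"
      then show "(f u, f v) \<in> parcs Y" using ia[of "(u, v)"] Y'(2) by force
    next
      assume "(f u, f v) \<in> parcs Y"
      then obtain a where a: "a \<in> parcs X" "(f u, f v) = (f (fst a), f (snd a))"
        using Y'(2) ia by auto
      then have "a = (u, v)"
        using sub[OF a(1)] uv inj by (cases a) (auto dest: inj_onD)
      then show "(u, v) \<in> parcs X" using a by simp
    qed
  qed
qed

lemma cycle_graph_arc: "(i, j) \<in> parcs (cycle_graph k) \<longleftrightarrow> i < k \<and> j < k \<and> cyc_adj k i j"
  by (auto simp: cycle_graph_def cyc_adj_def)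

text \<open>
  An induced circuit as an injective enumeration of its vertices, the form in which circuits are mapped
  between graphs.
\<close>

lemma has_induced_circuit_iff:
  assumes wf: "parcs X \<subseteq> pverts X \<times> pverts X"
  shows "has_induced_circuit X k \<longleftrightarrow> 3 \<le> k \<and>
    (\<exists>v. inj_on v {..<k} \<and> v ` {..<k} \<subseteq> pverts X \<and>
      (\<forall>i<k. \<forall>j<k. (v i, v j) \<in> parcs X \<longleftrightarrow> cyc_adj k i j))" (is "_ \<longleftrightarrow> _ \<and> (\<exists>v. ?hole v)")
proof (cases "3 \<le> k")
  case k: True
  have "(\<exists>H. induced_subgraph H (with_proj X) \<and> digraph_iso H (with_proj (cycle_graph k))) \<longleftrightarrow> (\<exists>v. ?hole v)"
  proof
    assume "\<exists>H. induced_subgraph H (with_proj X) \<and> digraph_iso H (with_proj (cycle_graph k))"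
    then obtain H where H: "induced_subgraph H (with_proj X)" "digraph_iso H (with_proj (cycle_graph k))" by blast
    define H' where "H' = \<lparr>pverts = verts H, parcs = arcs H\<rparr>"
    have "tail H = fst" "head H = snd"
      using H(1) by (auto simp: induced_subgraph_def subgraph_def compatible_def)
    then have HH: "H = with_proj H'" by (simp add: H'_def with_proj_def)
    have ind: "pverts H' \<subseteq> pverts X" "parcs H' = {e \<in> parcs X. fst e \<in> pverts H' \<and> snd e \<in> pverts H'}"
      using H(1) unfolding HH by (auto simp: induced_subgraph_def subgraph_def)
    have "wf_digraph H" using H(1) by (simp add: induced_subgraph_def subgraph_def)
    then have "digraph_iso (with_proj (cycle_graph k)) (with_proj H')"
      using digraph_iso_swap[OF _ H(2)] HH by simp
    then obtain v where v: "bij_betw v (pverts (cycle_graph k)) (pverts H')"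
      "\<And>i j. \<lbrakk>i \<in> pverts (cycle_graph k); j \<in> pverts (cycle_graph k)\<rbrakk> \<Longrightarrow>
        (i, j) \<in> parcs (cycle_graph k) \<longleftrightarrow> (v i, v j) \<in> parcs H'"
      by (rule digraph_isoE) blast
    have pv: "pverts (cycle_graph k) = {..<k}" by (simp add: cycle_graph_def)
    have "?hole v"
      using v ind unfolding pv cycle_graph_arc bij_betw_def by (auto 0 3)
    then show "\<exists>v. ?hole v" by blast
  next
    assume "\<exists>v. ?hole v"
    then obtain v where v: "?hole v" by blast
    define H where "H = \<lparr>pverts = v ` {..<k}, parcs = {e \<in> parcs X. fst e \<in> v ` {..<k} \<and> snd e \<in> v ` {..<k}}\<rparr>"
    have "induced_subgraph (with_proj H) (with_proj X)"
      using v wf by (auto simp: induced_subgraph_def subgraph_def compatible_def wf_digraph_def H_def)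
    moreover have "digraph_iso (with_proj (cycle_graph k)) (with_proj H)"
    proof (rule digraph_isoI[of v])
      show "bij_betw v (pverts (cycle_graph k)) (pverts H)"
        using v by (simp add: bij_betw_def H_def cycle_graph_def)
      show "parcs (cycle_graph k) \<subseteq> pverts (cycle_graph k) \<times> pverts (cycle_graph k)"
        by (auto simp: cycle_graph_def)
      show "parcs H \<subseteq> pverts H \<times> pverts H" by (auto simp: H_def)
      fix i j assume "i \<in> pverts (cycle_graph k)" "j \<in> pverts (cycle_graph k)"
      then show "(i, j) \<in> parcs (cycle_graph k) \<longleftrightarrow> (v i, v j) \<in> parcs H"
        unfolding cycle_graph_arc using v by (auto simp: H_def cycle_graph_def)
    qed
    moreover have "wf_digraph (with_proj (cycle_graph k))"
      by (auto simp: wf_digraph_def cycle_graph_def)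
    ultimately show "\<exists>H. induced_subgraph H (with_proj X) \<and> digraph_iso H (with_proj (cycle_graph k))"
      using digraph_iso_swap by blast
  qed
  then show ?thesis using k by (simp add: has_induced_circuit_def)
qed (simp add: has_induced_circuit_def)

lemma bipartiteI:
  "\<lbrakk>pverts X = A \<union> B; A \<inter> B = {}; parcs X \<subseteq> A \<times> B \<union> B \<times> A\<rbrakk> \<Longrightarrow> bipartite X"
  unfolding bipartite_def by blast

lemma balanced_iso:
  assumes bij: "bij_betw f (pverts X) (pverts Y)"
    and wf: "parcs X \<subseteq> pverts X \<times> pverts X" "parcs Y \<subseteq> pverts Y \<times> pverts Y"
    and arcs: "\<And>u v. \<lbrakk>u \<in> pverts X; v \<in> pverts X\<rbrakk> \<Longrightarrow> (u, v) \<in> parcs X \<longleftrightarrow> (f u, f v) \<in> parcs Y"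
    and Y: "balanced Y"
  shows "balanced X"
  unfolding balanced_def
proof
  obtain A B where AB: "pverts Y = A \<union> B" "A \<inter> B = {}" "parcs Y \<subseteq> A \<times> B \<union> B \<times> A"
    using Y by (auto simp: balanced_def bipartite_def)
  have img: "f u \<in> pverts Y" if "u \<in> pverts X" for u using bij that by (auto simp: bij_betw_def)
  have "parcs X \<subseteq> {u \<in> pverts X. f u \<in> A} \<times> {u \<in> pverts X. f u \<in> B} \<union> {u \<in> pverts X. f u \<in> B} \<times> {u \<in> pverts X. f u \<in> A}"
  proof
    fix e assume "e \<in> parcs X"
    moreover obtain u v where "e = (u, v)" by (cases e)
    ultimately have e: "e = (u, v)" "u \<in> pverts X" "v \<in> pverts X" "(f u, f v) \<in> parcs Y"
      using wf(1) arcs by auto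
    then show "e \<in> {u \<in> pverts X. f u \<in> A} \<times> {u \<in> pverts X. f u \<in> B} \<union> {u \<in> pverts X. f u \<in> B} \<times> {u \<in> pverts X. f u \<in> A}"
      using AB(3) by auto
  qed
  then show "bipartite X"
    using AB(1,2) img by (intro bipartiteI) auto
  show "\<nexists>k. k mod 4 = 2 \<and> has_induced_circuit X k"
  proof
    assume "\<exists>k. k mod 4 = 2 \<and> has_induced_circuit X k"
    then obtain k v where k: "k mod 4 = 2" "3 \<le> k" and v: "inj_on v {..<k}" "v ` {..<k} \<subseteq> pverts X"
      "\<forall>i<k. \<forall>j<k. (v i, v j) \<in> parcs X \<longleftrightarrow> cyc_adj k i j"
      unfolding has_induced_circuit_iff[OF wf(1)] by blast
    have "inj_on (f \<circ> v) {..<k}"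
      using v(1,2) bij by (intro comp_inj_on) (auto simp: bij_betw_def intro: inj_on_subset)
    moreover have "(f \<circ> v) ` {..<k} \<subseteq> pverts Y" using v(2) img by auto
    moreover have "\<forall>i<k. \<forall>j<k. ((f \<circ> v) i, (f \<circ> v) j) \<in> parcs Y \<longleftrightarrow> cyc_adj k i j"
    proof (intro allI impI)
      fix i j assume ij: "i < k" "j < k"
      then have "v i \<in> pverts X" "v j \<in> pverts X" using v(2) by auto
      from arcs[OF this] show "((f \<circ> v) i, (f \<circ> v) j) \<in> parcs Y \<longleftrightarrow> cyc_adj k i j"
        using v(3) ij by simp
    qed
    ultimately have "has_induced_circuit Y k" unfolding has_induced_circuit_iff[OF wf(2)] using k by blast
    then show False using Y k unfolding balanced_def by blast
  qed
qed

lemma lt_cycle_verts: "pverts (lt_cycle l t) = {..<l} \<times> {..<t}"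
  by (simp add: lt_cycle_def lex_product_def cycle_graph_def edgeless_graph_def)

lemma lt_cycle_arc:
  "(p, q) \<in> parcs (lt_cycle l t) \<longleftrightarrow> p \<in> {..<l} \<times> {..<t} \<and> q \<in> {..<l} \<times> {..<t} \<and> cyc_adj l (fst p) (fst q)"
  by (cases p; cases q) (auto simp: lt_cycle_def lex_product_def cycle_graph_def edgeless_graph_def cyc_adj_def)

lemma lt_cycle_wf: "parcs (lt_cycle l t) \<subseteq> pverts (lt_cycle l t) \<times> pverts (lt_cycle l t)"
  by (auto simp: lt_cycle_verts lt_cycle_arc)

text \<open>
  Vertices with equal first coordinates have the same neighbours, which on a circuit of length at least 5
  makes them equal. So the first coordinates are \<open>k\<close> distinct indices, each with two neighbours among
  them; as an index has only two neighbours on the \<open>l\<close>-circuit, the successor of each is again one of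
  them, and they exhaust the \<open>l\<close>-circuit.
\<close>

lemma lt_cycle_hole_length:
  assumes l: "0 < l" and k: "5 \<le> k"
    and v: "v ` {..<k} \<subseteq> {..<l} \<times> {..<t}"
    and adj: "\<And>i j. \<lbrakk>i < k; j < k\<rbrakk> \<Longrightarrow> cyc_adj l (fst (v i)) (fst (v j)) \<longleftrightarrow> cyc_adj k i j"
  shows "k = l"
proof -
  define c where "c i = fst (v i)" for i
  have cl: "c i < l" if "i < k" for i using v that by (auto simp: c_def)
  have adj: "cyc_adj l (c i) (c j) \<longleftrightarrow> cyc_adj k i j" if "i < k" "j < k" for i j
    using adj that by (simp add: c_def)
  have inj: "inj_on c {..<k}"
  proof (rule inj_onI)
    fix i j assume ij: "i \<in> {..<k}" "j \<in> {..<k}" "c i = c j"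
    then have "cyc_adj k i n \<longleftrightarrow> cyc_adj k j n" if "n < k" for n
      using adj[of i n] adj[of j n] that by simp
    then show "i = j" using ij by (intro cyc_adj_twins[OF k]) auto
  qed
  have step: "Suc x mod l \<in> c ` {..<k}" if x: "x \<in> c ` {..<k}" for x
  proof -
    obtain i where i: "i < k" "x = c i" using x by auto
    define n where "n = (if Suc i = k then 0 else Suc i)"
    define p where "p = (if i = 0 then k - 1 else i - 1)"
    have np: "n < k" "p < k" "n \<noteq> p" using i k by (auto simp: n_def p_def)
    have "cyc_adj k i n" "cyc_adj k i p"
      using i k by (auto simp: cyc_adj_def n_def p_def Suc_mod_if)
    then have "cyc_adj l x (c n)" "cyc_adj l x (c p)" using adj i np by auto
    moreover have "c n \<noteq> c p" using inj np by (auto dest: inj_onD)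
    moreover have "y = z" if "x = Suc y mod l" "x = Suc z mod l" "y < l" "z < l" for y z
      using that by (auto simp: Suc_mod_if split: if_splits)
    ultimately have "Suc x mod l = c n \<or> Suc x mod l = c p"
      unfolding cyc_adj_def using cl np by metis
    then show ?thesis using np by auto
  qed
  have "{..<l} \<subseteq> c ` {..<k}"
  proof
    fix y assume y: "y \<in> {..<l}"
    have c0: "c 0 < l" using cl k by simp
    have all: "(c 0 + n) mod l \<in> c ` {..<k}" for n
    proof (induction n)
      case 0 then show ?case using c0 k by simp
    next
      case (Suc n) then show ?case using step[OF Suc] by (simp add: mod_Suc_eq)
    qed
    have "(c 0 + (l - c 0 + y)) mod l = y" using c0 y by simp
    then show "y \<in> c ` {..<k}" using all[of "l - c 0 + y"] by simp
  qed
  then have "c ` {..<k} = {..<l}" using cl by auto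
  then show "k = l" using card_image[OF inj] by simp
qed

lemma balanced_lt_cycle:
  assumes l: "0 < l" "l = 2 \<or> l mod 4 = 0"
  shows "balanced (lt_cycle l t)"
  unfolding balanced_def
proof
  have "even l" using l by presburger
  then have par: "even (Suc i mod l) \<longleftrightarrow> odd i" for i by (simp add: dvd_mod_iff)
  have "parcs (lt_cycle l t) \<subseteq>
    {p \<in> {..<l} \<times> {..<t}. even (fst p)} \<times> {p \<in> {..<l} \<times> {..<t}. odd (fst p)} \<union>
    {p \<in> {..<l} \<times> {..<t}. odd (fst p)} \<times> {p \<in> {..<l} \<times> {..<t}. even (fst p)}"
  proof
    fix e assume "e \<in> parcs (lt_cycle l t)"
    moreover obtain p q where e: "e = (p, q)" by (cases e)
    ultimately have "p \<in> {..<l} \<times> {..<t}" "q \<in> {..<l} \<times> {..<t}" and "cyc_adj l (fst p) (fst q)"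
      by (auto simp: lt_cycle_arc)
    moreover from this(3) have "even (fst p) \<longleftrightarrow> odd (fst q)"
      using par[of "fst p"] par[of "fst q"] by (auto simp: cyc_adj_def)
    ultimately show "e \<in> {p \<in> {..<l} \<times> {..<t}. even (fst p)} \<times> {p \<in> {..<l} \<times> {..<t}. odd (fst p)} \<union>
    {p \<in> {..<l} \<times> {..<t}. odd (fst p)} \<times> {p \<in> {..<l} \<times> {..<t}. even (fst p)}"
      using e by blast
  qed
  then show "bipartite (lt_cycle l t)"
    by (rule bipartiteI[rotated 2]) (auto simp: lt_cycle_verts)
  show "\<nexists>k. k mod 4 = 2 \<and> has_induced_circuit (lt_cycle l t) k"
  proof
    assume "\<exists>k. k mod 4 = 2 \<and> has_induced_circuit (lt_cycle l t) k"
    then obtain k v where k: "k mod 4 = 2" "3 \<le> k" and v: "v ` {..<k} \<subseteq> {..<l} \<times> {..<t}"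
      "\<forall>i<k. \<forall>j<k. (v i, v j) \<in> parcs (lt_cycle l t) \<longleftrightarrow> cyc_adj k i j"
      unfolding has_induced_circuit_iff[OF lt_cycle_wf] lt_cycle_verts by blast
    have k5: "5 \<le> k" using k by presburger
    have "k = l"
    proof (rule lt_cycle_hole_length[OF l(1) k5 v(1)])
      fix i j assume ij: "i < k" "j < k"
      then have "v i \<in> {..<l} \<times> {..<t}" "v j \<in> {..<l} \<times> {..<t}" using v(1) by auto
      then show "cyc_adj l (fst (v i)) (fst (v j)) \<longleftrightarrow> cyc_adj k i j"
        using v(2)[rule_format, OF ij] by (simp add: lt_cycle_arc)
    qed
    then show False using k k5 l by auto
  qed
qed

section \<open>Balanced Cayley graphs\<close>

text \<open>
  Integer-valued functions stand for formal integer combinations of group elements; evaluating these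
  combinations maps the free abelian group on the elements of \<open>G\<close> onto \<open>G\<close>.
\<close>

lemma (in comm_group) finprod_int_pow_hom:
  assumes "finite (carrier G)"
  defines "\<phi> \<equiv> \<lambda>c :: 'a \<Rightarrow> int. \<Otimes>x\<in>carrier G. x [^] c x"
  shows "\<phi> (c + d) = \<phi> c \<otimes> \<phi> d" "\<phi> ` UNIV = carrier G"
proof -
  show "\<phi> (c + d) = \<phi> c \<otimes> \<phi> d"
  proof -
    have "\<phi> (c + d) = (\<Otimes>x\<in>carrier G. x [^] c x \<otimes> x [^] d x)"
      unfolding \<phi>_def by (intro finprod_cong') (auto simp: int_pow_mult)
    then show ?thesis by (simp add: \<phi>_def finprod_multf)
  qed
  show "\<phi> ` UNIV = carrier G"
  proof
    show "\<phi> ` UNIV \<subseteq> carrier G" by (auto simp: \<phi>_def)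
    show "carrier G \<subseteq> \<phi> ` UNIV"
    proof
      fix g assume g: "g \<in> carrier G"
      have "\<phi> (\<lambda>x. if g = x then 1 else 0) = (\<Otimes>x\<in>carrier G. if g = x then x else \<one>)"
        unfolding \<phi>_def by (intro finprod_cong') (auto simp: int_pow_1)
      also have "\<dots> = g" using finprod_singleton[OF g assms(1), of "\<lambda>x. x"] by simp
      finally show "g \<in> \<phi> ` UNIV" by (metis rangeI)
    qed
  qed
qed

lemma cayley_graph_simps:
  "pverts (cayley_graph G S) = carrier G"
  "(g, h) \<in> parcs (cayley_graph G S) \<longleftrightarrow> g \<in> carrier G \<and> h \<in> carrier G \<and> g \<otimes>\<^bsub>G\<^esub> inv\<^bsub>G\<^esub> h \<in> S"
  by (auto simp: cayley_graph_def)

lemma cayley_graph_wf: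
  "parcs (cayley_graph G S) \<subseteq> pverts (cayley_graph G S) \<times> pverts (cayley_graph G S)"
  by (auto simp: cayley_graph_def)

lemma (in group) connection_set_inv:
  assumes "S = m_inv G ` S" "g \<in> carrier G" "h \<in> carrier G" "g \<otimes> inv h \<in> S"
  shows "h \<otimes> inv g \<in> S"
proof -
  have "inv (g \<otimes> inv h) \<in> S" using assms(1,4) by blast
  then show ?thesis using assms(2,3) by (simp add: inv_mult_group)
qed

lemma (in group) connected_cayley_graph_induct:
  assumes con: "Digraph_Component.connected (with_proj (cayley_graph G S))"
    and S: "S = m_inv G ` S"
    and g: "g \<in> carrier G"
    and one: "P \<one>"
    and step: "\<And>s g. \<lbrakk>s \<in> S; g \<in> carrier G; P g\<rbrakk> \<Longrightarrow> P (s \<otimes> g)"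
  shows "P g"
proof -
  let ?M = "mk_symmetric (with_proj (cayley_graph G S))"
  have reach: "\<one> \<rightarrow>\<^sup>*\<^bsub>with_proj ?M\<^esub> g"
    using con g by (auto simp: connected_def strongly_connected_def mk_symmetric_def cayley_graph_simps)
  interpret M: wf_digraph "with_proj ?M"
    by (auto simp: wf_digraph_def mk_symmetric_def cayley_graph_def)
  from reach show "P g"
  proof (induction rule: M.reachable_induct)
    case base
    show ?case by (rule one)
  next
    case (step x y)
    then have "(x, y) \<in> parcs ?M" by simp
    then have "(x, y) \<in> parcs (cayley_graph G S) \<or> (y, x) \<in> parcs (cayley_graph G S)"
      by (auto simp: mk_symmetric_def)
    then have xy: "x \<in> carrier G" "y \<in> carrier G" "y \<otimes> inv x \<in> S"
      using connection_set_inv[OF S] by (auto simp: cayley_graph_simps)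
    have "P (y \<otimes> inv x \<otimes> x)" using assms(5)[OF xy(3,1) step(3)] .
    then show ?case using xy by (simp add: m_assoc)
  qed
qed

text \<open>
  The proof identifies the preimage \<open>T\<close> of \<open>S\<close> as a balanced connection set; its two cosets yield the
  isomorphism \<open>f\<close>, which sends \<open>(i, j)\<close> to the image of \<open>i b\<close> plus the \<open>j\<close>-th period.
\<close>

lemma (in comm_group) balanced_cayley_graph_imp_lt_cycle:
  assumes fin: "finite (carrier G)"
    and S: "S \<subseteq> carrier G - {\<one>}" "S \<noteq> {}" "S = m_inv G ` S"
    and con: "Digraph_Component.connected (with_proj (cayley_graph G S))"
    and bal: "balanced (cayley_graph G S)"
  obtains l t where "0 < l" "0 < t" "l = 2 \<or> l mod 4 = 0 \<and> 8 \<le> l"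
    "digraph_iso (with_proj (cayley_graph G S)) (with_proj (lt_cycle l t))"
proof -
  let ?X = "cayley_graph G S"
  define \<phi> where "\<phi> = (\<lambda>c :: 'a \<Rightarrow> int. \<Otimes>x\<in>carrier G. x [^] c x)"
  have \<phi>_add: "\<phi> (x + y) = \<phi> x \<otimes> \<phi> y" for x y
    unfolding \<phi>_def by (rule finprod_int_pow_hom(1)[OF fin])
  have \<phi>_surj: "range \<phi> = carrier G"
    unfolding \<phi>_def by (rule finprod_int_pow_hom(2)[OF fin])
  have \<phi>_closed [simp]: "\<phi> x \<in> carrier G" for x using \<phi>_surj by blast
  have preimage: "\<exists>x. \<phi> x = g" if "g \<in> carrier G" for g
    using that unfolding \<phi>_surj[symmetric] by auto
  have \<phi>_0 [simp]: "\<phi> 0 = \<one>"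
    using \<phi>_add[of 0 0] by (metis \<phi>_closed add_0 l_cancel_one')
  have \<phi>_minus: "\<phi> (- x) = inv \<phi> x" for x
    using \<phi>_add[of "- x" x] by (simp add: inv_equality)
  have \<phi>_diff: "\<phi> (x - y) = \<phi> x \<otimes> inv \<phi> y" for x y
    using \<phi>_add[of x "- y"] by (simp add: \<phi>_minus)
  define T where "T = {x. \<phi> x \<in> S}"
  have arc: "(\<phi> x, \<phi> y) \<in> parcs ?X \<longleftrightarrow> x - y \<in> T" for x y
    by (simp add: cayley_graph_simps T_def \<phi>_diff)

  obtain A B where AB: "carrier G = A \<union> B" "A \<inter> B = {}" "parcs ?X \<subseteq> A \<times> B \<union> B \<times> A"
    using bal by (auto simp: balanced_def bipartite_def cayley_graph_simps)
  \<comment> \<open>Since the graph is connected, the colour classes of a bipartition are the two cosets of a subgroup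
    of index 2: multiplication by an element of \<open>S\<close> changes the colour.\<close>
  define col where "col g \<longleftrightarrow> (g \<in> A \<longleftrightarrow> \<one> \<in> A)" for g
  have col_S: "col (s \<otimes> g) \<longleftrightarrow> \<not> col g" if "s \<in> S" "g \<in> carrier G" for s g
  proof -
    have "s \<in> carrier G" using that S(1) by blast
    then have "(s \<otimes> g, g) \<in> parcs ?X" using that by (simp add: cayley_graph_simps m_assoc)
    then show ?thesis using AB(2,3) unfolding col_def by blast
  qed
  have col_mult: "col (g \<otimes> h) \<longleftrightarrow> (col g \<longleftrightarrow> col h)" if "g \<in> carrier G" "h \<in> carrier G" for g h
    using that(1)
  proof (induction rule: connected_cayley_graph_induct[OF con S(3), consumes 1, case_names one step])
    case one
    then show ?case using that by (simp add: col_def)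
  next
    case (step s g)
    then have "s \<in> carrier G" using S(1) by blast
    then show ?case using step that(2) col_S by (auto simp: m_assoc)
  qed

  \<comment> \<open>A circuit in the pulled-back graph projects injectively, since it has no twins.\<close>
  have lift_hole: False if k: "k mod 4 = 2" "6 \<le> k"
    and v: "\<And>i j. \<lbrakk>i < k; j < k\<rbrakk> \<Longrightarrow> v i - v j \<in> T \<longleftrightarrow> cyc_adj k i j" for k v
  proof -
    have adj: "(\<phi> (v i), \<phi> (v j)) \<in> parcs ?X \<longleftrightarrow> cyc_adj k i j" if "i < k" "j < k" for i j
      unfolding arc by (rule v[OF that])
    have "inj_on (\<phi> \<circ> v) {..<k}"
    proof (rule inj_onI)
      fix i j assume ij: "i \<in> {..<k}" "j \<in> {..<k}" "(\<phi> \<circ> v) i = (\<phi> \<circ> v) j"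
      then have "cyc_adj k i n \<longleftrightarrow> cyc_adj k j n" if "n < k" for n
        using adj[of i n] adj[of j n] that by simp
      then show "i = j" using ij k by (intro cyc_adj_twins[of k]) auto
    qed
    then have "has_induced_circuit ?X k"
      unfolding has_induced_circuit_iff[OF cayley_graph_wf]
      using adj k by (auto simp: cayley_graph_simps(1) intro!: exI[of _ "\<phi> \<circ> v"])
    then show False using bal k unfolding balanced_def by blast
  qed

  interpret balanced_connection_set T "\<lambda>x. col (\<phi> x)"
  proof
    show "- x \<in> T" if "x \<in> T" for x using that S(3) by (auto simp: T_def \<phi>_minus)
    show "col (\<phi> (x + y)) \<longleftrightarrow> (col (\<phi> x) \<longleftrightarrow> col (\<phi> y))" for x y
      by (simp add: \<phi>_add col_mult)
    show "\<not> col (\<phi> x)" if "x \<in> T" for x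
      using col_S[of "\<phi> x" \<one>] that by (simp add: T_def col_def)
    have "(+) d ` T = {x. \<phi> x \<otimes> inv \<phi> d \<in> S}" for d
      by (rule Set.set_eqI) (simp only: mem_translate_iff mem_Collect_eq T_def \<phi>_diff)
    then have "range (\<lambda>d. (+) d ` T) \<subseteq> (\<lambda>g. {x. \<phi> x \<otimes> inv g \<in> S}) ` carrier G"
      by (simp add: image_subset_iff)
    then show "finite (range (\<lambda>d. (+) d ` T))" using fin finite_subset by blast
    show "\<exists>i<k. \<exists>j<k. (v i - v j \<in> T) \<noteq> cyc_adj k i j" if "k mod 4 = 2" "6 \<le> k" for k v
      using lift_hole[OF that, of v] by blast
  qed

  obtain s where "s \<in> S" using S(2) by blast
  then obtain x where "\<phi> x = s" using S(1) preimage by blast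
  then have "T \<noteq> {}" using \<open>s \<in> S\<close> by (auto simp: T_def)
  then obtain b where b: "\<And>x. x \<in> T \<longleftrightarrow> x - b \<in> periods \<or> x + b \<in> periods"
    using connection_set_two_cosets by blast
  obtain l where l: "0 < l" "\<And>z. of_int z * b \<in> periods \<longleftrightarrow> int l dvd z"
    using period_order[of b] by blast
  have kernel: "x - y \<in> periods" if xy: "\<phi> x = \<phi> y" for x y
  proof -
    have "z + (x - y) \<in> T \<longleftrightarrow> z \<in> T" for z
      by (simp add: T_def \<phi>_add[of z] \<phi>_diff xy)
    then show ?thesis by (simp only: periods_def mem_Collect_eq) blast
  qed
  have decomp: "\<exists>z k. k \<in> periods \<and> g = \<phi> (of_int z * b + k)" if "g \<in> carrier G" for g
    using that
  proof (induction rule: connected_cayley_graph_induct[OF con S(3), consumes 1, case_names one step])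
    case one
    have "\<one> = \<phi> (of_int 0 * b + 0)" by simp
    then show ?case using periods_0 by blast
  next
    case (step s g)
    then obtain z k where zk: "k \<in> periods" "g = \<phi> (of_int z * b + k)" by blast
    obtain x where x: "\<phi> x = s" using step(1) S(1) preimage by blast
    have sg: "s \<otimes> g = \<phi> (x + (of_int z * b + k))" using zk(2) x by (simp add: \<phi>_add)
    have "x \<in> T" using step(1) x by (simp add: T_def)
    then consider "x - b \<in> periods" | "x + b \<in> periods" using b by blast
    then show ?case
    proof cases
      case 1
      have "x + (of_int z * b + k) = of_int (z + 1) * b + (x - b + k)" by (simp add: algebra_simps)
      then show ?thesis using periods_add[OF 1 zk(1)] sg by metis
    next
      case 2
      have "x + (of_int z * b + k) = of_int (z - 1) * b + (x + b + k)" by (simp add: algebra_simps)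
      then show ?thesis using periods_add[OF 2 zk(1)] sg by metis
    qed
  qed

  define t where "t = card (\<phi> ` periods)"
  have fin_K: "finite (\<phi> ` periods)" using fin by (rule finite_subset[rotated]) auto
  then obtain \<kappa>' where \<kappa>': "bij_betw \<kappa>' {..<t} (\<phi> ` periods)"
    unfolding t_def using ex_bij_betw_nat_finite atLeast0LessThan by metis
  have \<kappa>'_image: "\<kappa>' ` {..<t} = \<phi> ` periods" using \<kappa>' by (simp add: bij_betw_def)
  have "\<exists>k. k \<in> periods \<and> \<phi> k = \<kappa>' j" if "j < t" for j
  proof -
    have "\<kappa>' j \<in> \<phi> ` periods" unfolding \<kappa>'_image[symmetric] using that by simp
    then show ?thesis by auto
  qed
  then obtain \<kappa> where \<kappa>: "\<And>j. j < t \<Longrightarrow> \<kappa> j \<in> periods \<and> \<phi> (\<kappa> j) = \<kappa>' j"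
    by metis
  define f where "f p = \<phi> (of_nat (fst p) * b + \<kappa> (snd p))" for p
  have f_arc: "(f p, f q) \<in> parcs ?X \<longleftrightarrow> cyc_adj l (fst p) (fst q)"
    if "p \<in> {..<l} \<times> {..<t}" "q \<in> {..<l} \<times> {..<t}" for p q
  proof -
    have "of_nat (fst p) * b + \<kappa> (snd p) - (of_nat (fst q) * b + \<kappa> (snd q))
      = of_nat (fst p) * b - of_nat (fst q) * b + (\<kappa> (snd p) - \<kappa> (snd q))" by simp
    moreover have "\<kappa> (snd p) - \<kappa> (snd q) \<in> periods" using \<kappa> that by (intro periods_diff) auto
    ultimately have "(f p, f q) \<in> parcs ?X \<longleftrightarrow> of_nat (fst p) * b - of_nat (fst q) * b \<in> T"
      unfolding f_def arc by (simp only: periodsD)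
    then show ?thesis using coset_multiple[OF b l(2)] that by auto
  qed
  have "bij_betw f ({..<l} \<times> {..<t}) (carrier G)"
    unfolding bij_betw_def
  proof
    show "inj_on f ({..<l} \<times> {..<t})"
    proof (rule inj_onI)
      fix p q assume pq: "p \<in> {..<l} \<times> {..<t}" "q \<in> {..<l} \<times> {..<t}" "f p = f q"
      have k: "\<kappa> (snd p) \<in> periods" "\<kappa> (snd q) \<in> periods" using \<kappa> pq by auto
      have "of_nat (fst p) * b + \<kappa> (snd p) - (of_nat (fst q) * b + \<kappa> (snd q)) \<in> periods"
        using kernel pq(3) unfolding f_def by blast
      from periods_diff[OF this periods_diff[OF k]]
      have "of_int (int (fst p) - int (fst q)) * b \<in> periods" by (simp add: algebra_simps)
      then have "int l dvd int (fst p) - int (fst q)" using l(2) by blast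
      then have fst: "fst p = fst q"
        using pq(1,2) by (auto simp: mod_eq_dvd_iff[symmetric])
      then have "\<phi> (\<kappa> (snd p)) = \<phi> (\<kappa> (snd q))" using pq(3) by (simp add: f_def \<phi>_add)
      then have "\<kappa>' (snd p) = \<kappa>' (snd q)" using \<kappa> pq by auto
      then have "snd p = snd q" using \<kappa>' pq unfolding bij_betw_def by (auto dest!: inj_onD)
      then show "p = q" using fst by (simp add: prod_eq_iff)
    qed
    show "f ` ({..<l} \<times> {..<t}) = carrier G"
    proof
      show "f ` ({..<l} \<times> {..<t}) \<subseteq> carrier G" by (auto simp: f_def)
      show "carrier G \<subseteq> f ` ({..<l} \<times> {..<t})"
      proof
        fix g assume "g \<in> carrier G"
        then obtain z k where zk: "k \<in> periods" "g = \<phi> (of_int z * b + k)" using decomp by blast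
        define r where "r = nat (z mod int l)"
        have r: "r < l" "z mod int l = int r" using l(1) by (auto simp: r_def nat_less_iff)
        have "of_int (z - int r) * b \<in> periods" using l(2) r(2) by (metis dvd_minus_mod)
        then have "of_int (z - int r) * b + k \<in> periods" using zk(1) by (rule periods_add)
        then have "\<phi> (of_int (z - int r) * b + k) \<in> \<kappa>' ` {..<t}" unfolding \<kappa>'_image by (rule imageI)
        then obtain j where j: "j < t" "\<kappa>' j = \<phi> (of_int (z - int r) * b + k)" by auto
        have "g = \<phi> (of_nat r * b) \<otimes> \<phi> (of_int (z - int r) * b + k)"
          unfolding zk(2) \<phi>_add[symmetric] by (simp add: algebra_simps)
        also have "\<dots> = f (r, j)" using j \<kappa>[OF j(1)] by (simp add: f_def \<phi>_add)
        finally show "g \<in> f ` ({..<l} \<times> {..<t})" using r j by blast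
      qed
    qed
  qed
  then have "digraph_iso (with_proj (lt_cycle l t)) (with_proj ?X)"
    using f_arc
    by (intro digraph_isoI[of f] lt_cycle_wf cayley_graph_wf)
      (auto simp: lt_cycle_verts lt_cycle_arc cayley_graph_simps(1))
  moreover have "wf_digraph (with_proj (lt_cycle l t))"
    using lt_cycle_wf[of l t] by (auto simp: wf_digraph_def)
  ultimately have iso: "digraph_iso (with_proj ?X) (with_proj (lt_cycle l t))"
    by (rule digraph_iso_swap[rotated])
  have "\<phi> ` periods \<noteq> {}" using periods_0 by blast
  then have t: "0 < t" using fin_K by (simp add: t_def card_gt_0_iff)
  show ?thesis by (rule that[OF l(1) t cycle_length[OF b l] iso])
qed

theorem theorem1p2:
  fixes G :: "('a, 'b) monoid_scheme" and S :: "'a set"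
  assumes "comm_group G"
    and "finite (carrier G)"
    and "S \<subseteq> carrier G - {\<one>\<^bsub>G\<^esub>}"
    and "S \<noteq> {}"
    and "S = m_inv G ` S"
    and "Digraph_Component.connected (with_proj (cayley_graph G S))"
  shows "balanced (cayley_graph G S) \<longleftrightarrow>
    (\<exists>l t. 0 < l \<and> 0 < t \<and> (l = 2 \<or> l mod 4 = 0 \<and> 8 \<le> l) \<and>
      digraph_iso (with_proj (cayley_graph G S)) (with_proj (lt_cycle l t)))"
proof
  assume bal: "balanced (cayley_graph G S)"
  show "\<exists>l t. 0 < l \<and> 0 < t \<and> (l = 2 \<or> l mod 4 = 0 \<and> 8 \<le> l) \<and>
      digraph_iso (with_proj (cayley_graph G S)) (with_proj (lt_cycle l t))"
    by (rule comm_group.balanced_cayley_graph_imp_lt_cycle[OF assms bal]) (intro exI conjI)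
next
  assume "\<exists>l t. 0 < l \<and> 0 < t \<and> (l = 2 \<or> l mod 4 = 0 \<and> 8 \<le> l) \<and>
      digraph_iso (with_proj (cayley_graph G S)) (with_proj (lt_cycle l t))"
  then obtain l t where lt: "0 < l \<and> 0 < t \<and> (l = 2 \<or> l mod 4 = 0 \<and> 8 \<le> l) \<and>
      digraph_iso (with_proj (cayley_graph G S)) (with_proj (lt_cycle l t))"
    by (elim exE)
  then have l: "0 < l" "l = 2 \<or> l mod 4 = 0"
    and iso: "digraph_iso (with_proj (cayley_graph G S)) (with_proj (lt_cycle l t))" by auto
  show "balanced (cayley_graph G S)"
  proof (rule digraph_isoE[OF iso])
    fix f assume "bij_betw f (pverts (cayley_graph G S)) (pverts (lt_cycle l t))"
      and "\<And>u v. \<lbrakk>u \<in> pverts (cayley_graph G S); v \<in> pverts (cayley_graph G S)\<rbrakk> \<Longrightarrow>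
        (u, v) \<in> parcs (cayley_graph G S) \<longleftrightarrow> (f u, f v) \<in> parcs (lt_cycle l t)"
    then show ?thesis
      by (rule balanced_iso[OF _ cayley_graph_wf lt_cycle_wf _ balanced_lt_cycle[OF l]])
  qed
qed

end
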